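(* Let $p>2$ (with $p<\infty$) and $0<q\le1$. Then $L_{p,q}(0,\infty)$ does not embed isomorphically into $L_{p,q}(0,1)$. In particular, the two spaces are not isomorphic.
   Context: For $I=(0,1)$ or $I=(0,\infty)$ with Lebesgue measure $m$ and a measurable scalar function $f$ on $I$, $f^*(t)=\inf\{\lambda>0:m\{|f|>\lambda\}\le t\}$, $t>0$. For $0<p,q<\infty$, $L_{p,q}(I)$ is the space of measurable $f$ on $I$ with $\|f\|_{p,q}=\left(\int_0^\infty [t^{1/p}f^*(t)]^q\,\frac{dt}{t}\right)^{1/q}<\infty$ (a quasi-norm). A quasi-Banach space $X$ embeds isomorphically into $Y$ if there are a linear map $T:X\to Y$ and $C\ge1$ with $C^{-1}\|x\|_X\le\|Tx\|_Y\le C\|x\|_X$ for all $x\in X$; $X$ and $Y$ are isomorphic if such a $T$ can be chosen onto. *)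

theory Defs
  imports "HOL-Analysis.Analysis"
begin

section \<open>Quasi-normed spaces, isomorphic embeddings\<close>

record ('k, 'v) qn_space =
  vectors :: "'v set"
  vadd :: "'v \<Rightarrow> 'v \<Rightarrow> 'v"
  vscale :: "'k \<Rightarrow> 'v \<Rightarrow> 'v"
  qnorm :: "'v \<Rightarrow> real"

definition linear_map :: "('k, 'v) qn_space \<Rightarrow> ('k, 'w) qn_space \<Rightarrow> ('v \<Rightarrow> 'w) \<Rightarrow> bool" where
  "linear_map X Y T \<longleftrightarrow>
     (\<forall>x\<in>vectors X. T x \<in> vectors Y) \<and>
     (\<forall>x\<in>vectors X. \<forall>y\<in>vectors X. T (vadd X x y) = vadd Y (T x) (T y)) \<and>
     (\<forall>c. \<forall>x\<in>vectors X. T (vscale X c x) = vscale Y c (T x))"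

definition isomorphic_embedding ::
  "('k, 'v) qn_space \<Rightarrow> ('k, 'w) qn_space \<Rightarrow> ('v \<Rightarrow> 'w) \<Rightarrow> bool" where
  "isomorphic_embedding X Y T \<longleftrightarrow> linear_map X Y T \<and>
     (\<exists>C::real. 1 \<le> C \<and>
        (\<forall>x\<in>vectors X. inverse C * qnorm X x \<le> qnorm Y (T x) \<and> qnorm Y (T x) \<le> C * qnorm X x))"

definition embeds_isomorphically :: "('k, 'v) qn_space \<Rightarrow> ('k, 'w) qn_space \<Rightarrow> bool" where
  "embeds_isomorphically X Y \<longleftrightarrow> (\<exists>T. isomorphic_embedding X Y T)"

definition isomorphic :: "('k, 'v) qn_space \<Rightarrow> ('k, 'w) qn_space \<Rightarrow> bool" where
  "isomorphic X Y \<longleftrightarrow> (\<exists>T. isomorphic_embedding X Y T \<and> T ` vectors X = vectors Y)"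

section \<open>Lorentz spaces\<close>

text \<open>Powers of extended nonnegative numbers; only used for exponents \<open>a > 0\<close>,
  where \<open>\<infinity>\<close> to the power \<open>a\<close> is \<open>\<infinity>\<close> and \<open>0\<close> to the power \<open>a\<close> is \<open>0\<close>.\<close>

definition epowr :: "ennreal \<Rightarrow> real \<Rightarrow> ennreal" where
  "epowr x a = (if x = \<infinity> then \<infinity> else ennreal (enn2real x powr a))"

text \<open>The value is \<open>\<infinity>\<close> (the infimum of the empty set) if no level \<open>s\<close> qualifies.\<close>

definition decr_rearr :: "real set \<Rightarrow> (real \<Rightarrow> 'a::real_normed_field) \<Rightarrow> real \<Rightarrow> ennreal" where
  "decr_rearr I f t =
     (INF s\<in>{s::real. 0 < s \<and> emeasure lebesgue {x\<in>I. s < norm (f x)} \<le> ennreal t}. ennreal s)"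

definition lorentz_norm ::
  "real \<Rightarrow> real \<Rightarrow> real set \<Rightarrow> (real \<Rightarrow> 'a::real_normed_field) \<Rightarrow> ennreal" where
  "lorentz_norm p q I f =
     epowr (\<integral>\<^sup>+t\<in>{0<..}. epowr (ennreal (t powr (1 / p)) * decr_rearr I f t) q * ennreal (1 / t) \<partial>lborel)
       (1 / q)"

text \<open>Functions on \<open>I\<close> are represented by functions on \<open>\<real>\<close> whose values outside \<open>I\<close> are
  irrelevant. Elements of the Lorentz space are classes of measurable functions modulo equality
  almost everywhere on \<open>I\<close>.\<close>

definition ae_class :: "real set \<Rightarrow> (real \<Rightarrow> 'a) \<Rightarrow> (real \<Rightarrow> 'a::real_normed_field) set" where
  "ae_class I f =
     {g \<in> borel_measurable (lebesgue_on I). AE x in lebesgue_on I. g x = f x}"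

definition lorentz_space ::
  "real \<Rightarrow> real \<Rightarrow> real set \<Rightarrow> ('a::real_normed_field, (real \<Rightarrow> 'a) set) qn_space" where
  "lorentz_space p q I =
     \<lparr> vectors = ae_class I ` {f \<in> borel_measurable (lebesgue_on I). lorentz_norm p q I f < \<infinity>},
       vadd = (\<lambda>A B. \<Union>f\<in>A. \<Union>g\<in>B. ae_class I (\<lambda>x. f x + g x)),
       vscale = (\<lambda>c A. \<Union>f\<in>A. ae_class I (\<lambda>x. c * f x)),
       qnorm = (\<lambda>A. enn2real (the_elem (lorentz_norm p q I ` A))) \<rparr>"

text \<open>The operations and the quasi-norm do not depend on the representatives.\<close>

lemma ae_class_self:
  "f \<in> borel_measurable (lebesgue_on I) \<Longrightarrow> f \<in> ae_class I f"
  by (simp add: ae_class_def)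

lemma ae_class_cong:
  assumes "AE x in lebesgue_on I. f x = g x"
  shows "ae_class I f = ae_class I g"
proof -
  have "(AE x in lebesgue_on I. h x = f x) \<longleftrightarrow> (AE x in lebesgue_on I. h x = g x)" for h
    by (rule eventually_cong[OF assms]) simp
  then show ?thesis by (simp only: ae_class_def)
qed

lemma ae_class_eq_iff:
  assumes "f \<in> borel_measurable (lebesgue_on I)"
  shows "ae_class I f = ae_class I g \<longleftrightarrow> (AE x in lebesgue_on I. f x = g x)"
proof
  assume "ae_class I f = ae_class I g"
  then have "f \<in> ae_class I g"
    using ae_class_self[OF assms] by blast
  then show "AE x in lebesgue_on I. f x = g x"
    unfolding ae_class_def by blast
qed (rule ae_class_cong)

lemma vadd_lorentz_space:
  assumes "f \<in> borel_measurable (lebesgue_on I)" "g \<in> borel_measurable (lebesgue_on I)"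
  shows "vadd (lorentz_space p q I) (ae_class I f) (ae_class I g) = ae_class I (\<lambda>x. f x + g x)"
proof -
  have "ae_class I (\<lambda>x. f' x + g' x) = ae_class I (\<lambda>x. f x + g x)"
    if "f' \<in> ae_class I f" "g' \<in> ae_class I g" for f' g'
  proof (rule ae_class_cong)
    have "AE x in lebesgue_on I. f' x = f x" "AE x in lebesgue_on I. g' x = g x"
      using that unfolding ae_class_def by blast+
    then show "AE x in lebesgue_on I. f' x + g' x = f x + g x"
      by eventually_elim simp
  qed
  then have "(\<Union>f'\<in>ae_class I f. \<Union>g'\<in>ae_class I g. ae_class I (\<lambda>x. f' x + g' x)) =
      (\<Union>f'\<in>ae_class I f. \<Union>g'\<in>ae_class I g. ae_class I (\<lambda>x. f x + g x))"
    by (intro SUP_cong refl)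
  also have "\<dots> = ae_class I (\<lambda>x. f x + g x)"
    using ae_class_self[OF assms(1)] ae_class_self[OF assms(2)] by blast
  finally show ?thesis
    by (simp add: lorentz_space_def)
qed

lemma vscale_lorentz_space:
  assumes "f \<in> borel_measurable (lebesgue_on I)"
  shows "vscale (lorentz_space p q I) c (ae_class I f) = ae_class I (\<lambda>x. c * f x)"
proof -
  have "ae_class I (\<lambda>x. c * f' x) = ae_class I (\<lambda>x. c * f x)" if "f' \<in> ae_class I f" for f'
  proof (rule ae_class_cong)
    have "AE x in lebesgue_on I. f' x = f x"
      using that unfolding ae_class_def by blast+
    then show "AE x in lebesgue_on I. c * f' x = c * f x"
      by eventually_elim simp
  qed
  then have "(\<Union>f'\<in>ae_class I f. ae_class I (\<lambda>x. c * f' x)) =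
      (\<Union>f'\<in>ae_class I f. ae_class I (\<lambda>x. c * f x))"
    by (intro SUP_cong refl)
  also have "\<dots> = ae_class I (\<lambda>x. c * f x)"
    using ae_class_self[OF assms] by blast
  finally show ?thesis
    by (simp add: lorentz_space_def)
qed

lemma lorentz_norm_cong_AE:
  assumes I: "I \<in> sets lebesgue"
    and f: "f \<in> borel_measurable (lebesgue_on I)" and g: "g \<in> borel_measurable (lebesgue_on I)"
    and ae: "AE x in lebesgue_on I. f x = g x"
  shows "lorentz_norm p q I f = lorentz_norm p q I g"
proof -
  have meas: "{x\<in>I. l < norm (h x)} \<in> sets lebesgue"
    if "h \<in> borel_measurable (lebesgue_on I)" for h :: "real \<Rightarrow> 'a" and l
  proof -
    have "{x \<in> space (lebesgue_on I). l < norm (h x)} \<in> sets (lebesgue_on I)"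
      using that by measurable
    then have "{x\<in>I. l < norm (h x)} \<in> sets (lebesgue_on I)"
      by simp
    then show ?thesis
      using I by (simp add: sets_restrict_space_iff)
  qed
  have ae': "AE x in lebesgue. x \<in> I \<longrightarrow> f x = g x"
    using ae I by (simp add: AE_restrict_space_iff)
  have "emeasure lebesgue {x\<in>I. l < norm (f x)} = emeasure lebesgue {x\<in>I. l < norm (g x)}" for l
  proof (rule emeasure_eq_AE)
    show "AE x in lebesgue. x \<in> {x\<in>I. l < norm (f x)} \<longleftrightarrow> x \<in> {x\<in>I. l < norm (g x)}"
      using ae' by eventually_elim auto
  qed (rule meas[OF f], rule meas[OF g])
  then have "decr_rearr I f = decr_rearr I g"
    by (simp add: decr_rearr_def fun_eq_iff)
  then show ?thesis
    by (simp add: lorentz_norm_def)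
qed

lemma qnorm_lorentz_space:
  assumes "I \<in> sets lebesgue" "f \<in> borel_measurable (lebesgue_on I)"
  shows "qnorm (lorentz_space p q I) (ae_class I f) = enn2real (lorentz_norm p q I f)"
proof -
  have "lorentz_norm p q I g = lorentz_norm p q I f" if "g \<in> ae_class I f" for g
  proof (rule lorentz_norm_cong_AE[OF assms(1) _ assms(2)])
    show "g \<in> borel_measurable (lebesgue_on I)" "AE x in lebesgue_on I. g x = f x"
      using that unfolding ae_class_def by blast+
  qed
  then have "lorentz_norm p q I ` ae_class I f = {lorentz_norm p q I f}"
    using ae_class_self[OF assms(2)] by blast
  then show ?thesis
    by (simp add: lorentz_space_def)
qed

end

theory Submission
  imports Defs
begin

text \<open>
  Write \<open>s = q / p < 1\<close> and \<open>W f = \<integral> t powr (s - 1) * (f\<^sup>* t) powr q dt\<close>, the \<open>q\<close>-th power of the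
  quasi-norm. Already the span of the indicators of \<open>(i, i + 1]\<close> in \<open>L\<^sub>p\<^sub>,\<^sub>q(0,\<infinity>)\<close> does not embed:
  let \<open>f\<^sub>i\<close> be their images in \<open>L\<^sub>p\<^sub>,\<^sub>q(0,1)\<close>, so that \<open>W\<close> of any signed sum of \<open>k\<close> of the \<open>f\<^sub>i\<close> is at most
  a constant times \<open>k powr s\<close>.
  Since \<open>p > 2\<close>, \<open>L\<^sub>p\<^sub>,\<^sub>q(0,1)\<close> is contained in \<open>L\<^sub>2\<close>, where suitable signs make the squared norm of the sum
  at least the sum of the squared norms; as \<open>2 / p < 1\<close>, this forces \<open>f\<^sub>i\<close> to tend to \<open>0\<close> in measure.
  But \<open>W (g + f\<^sub>i)\<close> is almost \<open>W g + 2 powr (- s) * W f\<^sub>i\<close> or larger once \<open>f\<^sub>i\<close> is small in measure, so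
  one can choose \<open>N\<close> of the \<open>f\<^sub>i\<close> whose sum has \<open>W\<close> at least a constant times \<open>N\<close>, a contradiction.
\<close>

section \<open>Powers and decreasing rearrangements\<close>

lemma epowr_ennreal: "0 \<le> x \<Longrightarrow> epowr (ennreal x) a = ennreal (x powr a)"
  by (simp add: epowr_def)

lemma epowr_top [simp]: "epowr top a = top"
  by (simp add: epowr_def)

lemma epowr_0 [simp]: "epowr 0 a = 0"
  by (simp add: epowr_def)

lemma epowr_1 [simp]: "epowr 1 a = 1"
  using epowr_ennreal[of 1 a] by simp

lemma epowr_mono:
  assumes "0 \<le> a" "x \<le> y"
  shows "epowr x a \<le> epowr y a"
proof (cases y)
  case (real r)
  then obtain u where u: "x = ennreal u" "0 \<le> u"
    using assms(2) by (cases x) (auto simp: top_unique)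
  then show ?thesis
    using real assms by (auto simp: epowr_ennreal intro!: ennreal_leI powr_mono2)
qed simp

text \<open>Dividing by \<open>x + y\<close> reduces the claim to fractions in the unit interval,
  where \<open>u \<le> u powr a\<close> because \<open>a \<le> 1\<close>; the two fractions add up
  to 1.\<close>

lemma powr_add_le:
  fixes x y a :: real
  assumes "0 \<le> x" "0 \<le> y" "0 < a" "a \<le> 1"
  shows "(x + y) powr a \<le> x powr a + y powr a"
proof (cases "x + y = 0")
  case True
  then show ?thesis using assms by simp
next
  case False
  then have pos: "0 < x + y" using assms by linarith
  have le: "u / (x + y) \<le> (u / (x + y)) powr a" if "0 \<le> u" "u \<le> x + y" for u
  proof (cases "u = 0")
    case False
    then show ?thesis
      using powr_mono'[of a 1 "u / (x + y)"] that assms pos by (simp add: field_simps)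
  qed simp
  have "1 = x / (x + y) + y / (x + y)"
    using pos by (simp flip: add_divide_distrib)
  also have "\<dots> \<le> (x / (x + y)) powr a + (y / (x + y)) powr a"
    using assms by (intro add_mono le) auto
  also have "\<dots> = (x powr a + y powr a) / (x + y) powr a"
    using assms pos by (simp add: powr_divide add_divide_distrib)
  finally show ?thesis
    using pos by (simp add: pos_le_divide_eq)
qed

lemma epowr_add_le:
  assumes "0 < a" "a \<le> 1"
  shows "epowr (x + y) a \<le> epowr x a + epowr y a"
proof (cases x)
  case x: (real r)
  show ?thesis
  proof (cases y)
    case (real r')
    with x show ?thesis
      using assms powr_add_le[of r r' a]
      by (simp add: epowr_ennreal ennreal_leI flip: ennreal_plus)
  qed simp
qed simp

lemma epowr_mult_ennreal:
  assumes "0 < c"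
  shows "epowr (ennreal c * x) a = ennreal (c powr a) * epowr x a"
proof (cases x)
  case (real r)
  then show ?thesis
    using assms by (simp add: epowr_ennreal powr_mult flip: ennreal_mult)
next
  case top
  then show ?thesis
    using assms by (simp add: ennreal_mult_top)
qed

lemma epowr_le_iff:
  assumes "0 < a" "0 \<le> c"
  shows "epowr x a \<le> ennreal c \<longleftrightarrow> x \<le> ennreal (c powr (1 / a))"
proof (cases x)
  case (real r)
  have "r powr a \<le> c \<longleftrightarrow> r \<le> c powr (1 / a)"
  proof
    assume "r powr a \<le> c"
    then have "(r powr a) powr (1 / a) \<le> c powr (1 / a)"
      using assms by (intro powr_mono2) auto
    then show "r \<le> c powr (1 / a)"
      using assms real by (simp add: powr_powr)
  next
    assume "r \<le> c powr (1 / a)"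
    then have "r powr a \<le> (c powr (1 / a)) powr a"
      using assms real by (intro powr_mono2) auto
    then show "r powr a \<le> c"
      using assms by (simp add: powr_powr)
  qed
  then show ?thesis
    using real assms by (simp add: epowr_ennreal)
qed (auto simp: top_unique)

section \<open>Level sets, monotonicity and subadditivity of decreasing rearrangements\<close>

lemma decr_rearr_le:
  assumes "0 < l" "emeasure lebesgue {x\<in>I. l < norm (f x)} \<le> ennreal t"
  shows "decr_rearr I f t \<le> ennreal l"
  unfolding decr_rearr_def using assms by (intro INF_lower CollectI conjI)

lemma decr_rearr_less:
  assumes "decr_rearr I f t < ennreal l"
  obtains r where "0 < r" "r < l" "emeasure lebesgue {x\<in>I. r < norm (f x)} \<le> ennreal t"
proof -
  obtain r where r: "0 < r" "emeasure lebesgue {x\<in>I. r < norm (f x)} \<le> ennreal t"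
    "ennreal r < ennreal l"
    using assms unfolding decr_rearr_def INF_less_iff by blast
  from r(1,3) have "r < l"
    by (subst (asm) ennreal_less_iff) simp_all
  with r(1) show ?thesis
    using r(2) by (rule that)
qed

lemma sets_level:
  fixes f :: "real \<Rightarrow> 'a::real_normed_field"
  assumes "I \<in> sets lebesgue" "f \<in> borel_measurable (lebesgue_on I)"
  shows "{x\<in>I. l < norm (f x)} \<in> sets lebesgue"
proof -
  have "{x \<in> space (lebesgue_on I). l < norm (f x)} \<in> sets (lebesgue_on I)"
    using assms(2) by measurable
  then show ?thesis
    using assms(1) by (simp add: sets_restrict_space_iff)
qed

lemma emeasure_lebesgue_on_Collect:
  assumes "I \<in> sets lebesgue"
  shows "emeasure (lebesgue_on I) {x\<in>I. P x} = emeasure lebesgue {x\<in>I. P x}"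
  by (rule emeasure_restrict_space) (use assms in auto)

text \<open>The strict inequality puts an admissible level below \<open>l\<close>, and the level set
  at \<open>l\<close> lies inside the one at that level. This avoids asking whether the infimum is
  attained.\<close>

lemma emeasure_level_le:
  fixes f :: "real \<Rightarrow> 'a::real_normed_field"
  assumes I: "I \<in> sets lebesgue" and f: "f \<in> borel_measurable (lebesgue_on I)"
    and "decr_rearr I f t < ennreal l"
  shows "emeasure lebesgue {x\<in>I. l < norm (f x)} \<le> ennreal t"
proof -
  obtain r where r: "r < l" "emeasure lebesgue {x\<in>I. r < norm (f x)} \<le> ennreal t"
    by (rule decr_rearr_less[OF assms(3)])
  from r(1) have "{x\<in>I. l < norm (f x)} \<subseteq> {x\<in>I. r < norm (f x)}"
    by auto
  then have "emeasure lebesgue {x\<in>I. l < norm (f x)} \<le> emeasure lebesgue {x\<in>I. r < norm (f x)}"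
    by (intro emeasure_mono sets_level[OF I f])
  then show ?thesis using r(2) by (rule order_trans)
qed

lemma decr_rearr_antimono: "t \<le> u \<Longrightarrow> decr_rearr I f u \<le> decr_rearr I f t"
  unfolding decr_rearr_def
  by (intro INF_superset_mono) (blast intro: order_trans[OF _ ennreal_leI], rule order_refl)

text \<open>Only positive levels compete in the infimum, so the value 0 is reached by letting the
  admissible level \<open>e\<close> tend to 0.\<close>

lemma decr_rearr_eq_0:
  assumes "emeasure lebesgue I \<le> ennreal t" "I \<in> sets lebesgue"
  shows "decr_rearr I f t = 0"
proof -
  have "decr_rearr I f t \<le> 0 + ennreal e" if "0 < e" for e
  proof -
    have le: "emeasure lebesgue {x\<in>I. e < norm (f x)} \<le> emeasure lebesgue I"
      using assms(2) by (intro emeasure_mono) blast+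
    show ?thesis
      unfolding add_0 by (rule decr_rearr_le[OF that order_trans[OF le assms(1)]])
  qed
  then have "decr_rearr I f t \<le> 0"
    by (rule ennreal_le_epsilon)
  then show ?thesis by simp
qed

text \<open>Where the sum exceeds \<open>a + b + e\<close> in norm, one summand exceeds its share
  \<open>a + e / 2\<close> or \<open>b + e / 2\<close>, so the measures of the two level sets add
  up. The slack \<open>e\<close> provides the strict inequalities and is removed at the end.\<close>

lemma decr_rearr_add:
  fixes f g :: "real \<Rightarrow> 'a::real_normed_field"
  assumes I: "I \<in> sets lebesgue" and f: "f \<in> borel_measurable (lebesgue_on I)"
    and g: "g \<in> borel_measurable (lebesgue_on I)" and "0 \<le> t" "0 \<le> u"
  shows "decr_rearr I (\<lambda>x. f x + g x) (t + u) \<le> decr_rearr I f t + decr_rearr I g u"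
proof (cases "decr_rearr I f t = top \<or> decr_rearr I g u = top")
  case False
  then obtain a b where ab: "decr_rearr I f t = ennreal a" "0 \<le> a" "decr_rearr I g u = ennreal b" "0 \<le> b"
    by (metis ennreal_cases)
  have "decr_rearr I (\<lambda>x. f x + g x) (t + u) \<le> ennreal (a + b) + ennreal e" if e: "0 < e" for e
  proof -
    let ?A = "{x\<in>I. a + e / 2 < norm (f x)}" and ?B = "{x\<in>I. b + e / 2 < norm (g x)}"
    have "decr_rearr I f t < ennreal (a + e / 2)" "decr_rearr I g u < ennreal (b + e / 2)"
      unfolding ab using ab(2,4) e by (simp_all add: ennreal_lessI)
    then have A: "emeasure lebesgue ?A \<le> ennreal t" and B: "emeasure lebesgue ?B \<le> ennreal u"
      using emeasure_level_le[OF I f] emeasure_level_le[OF I g] by blast+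
    have "{x\<in>I. a + b + e < norm (f x + g x)} \<subseteq> ?A \<union> ?B"
    proof
      fix x assume x: "x \<in> {x\<in>I. a + b + e < norm (f x + g x)}"
      have "a + b + e < norm (f x) + norm (g x)"
        using x norm_triangle_ineq[of "f x" "g x"] by simp
      then have "a + e / 2 < norm (f x) \<or> b + e / 2 < norm (g x)"
        by linarith
      with x show "x \<in> ?A \<union> ?B" by blast
    qed
    then have "emeasure lebesgue {x\<in>I. a + b + e < norm (f x + g x)} \<le> emeasure lebesgue (?A \<union> ?B)"
      by (intro emeasure_mono sets.Un sets_level I f g)
    also have "\<dots> \<le> emeasure lebesgue ?A + emeasure lebesgue ?B"
      by (intro emeasure_subadditive sets_level I f g)
    also have "\<dots> \<le> ennreal t + ennreal u"
      using A B by (rule add_mono)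
    also have "\<dots> = ennreal (t + u)"
      using assms by simp
    finally have le: "emeasure lebesgue {x\<in>I. a + b + e < norm (f x + g x)} \<le> ennreal (t + u)" .
    have "0 < a + b + e" using ab e by simp
    then have "decr_rearr I (\<lambda>x. f x + g x) (t + u) \<le> ennreal (a + b + e)"
      using le by (rule decr_rearr_le)
    then show ?thesis
      using ab e by simp
  qed
  then have "decr_rearr I (\<lambda>x. f x + g x) (t + u) \<le> ennreal (a + b)"
    by (rule ennreal_le_epsilon)
  then show ?thesis
    using ab by simp
qed auto

lemma decr_rearr_uminus [simp]: "decr_rearr I (\<lambda>x. - f x) = decr_rearr I f"
  unfolding decr_rearr_def norm_minus_cancel ..

lemma borel_measurable_decr_rearr [measurable]: "decr_rearr I f \<in> borel_measurable borel"
proof (rule borel_measurableI_greater)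
  fix y
  \<comment> \<open>Superlevel sets of a nonincreasing function are intervals, hence Borel.\<close>
  have "is_interval {t. y < decr_rearr I f t}"
    unfolding is_interval_1 by (auto intro: less_le_trans decr_rearr_antimono)
  then show "{t \<in> space borel. y < decr_rearr I f t} \<in> sets borel"
    by (simp add: real_interval_borel_measurable)
qed

lemma borel_measurable_epowr [measurable]: "(\<lambda>x. epowr x a) \<in> borel_measurable borel"
  unfolding epowr_def by measurable

section \<open>The modular of a Lorentz space\<close>

definition lorentz_density ::
  "real \<Rightarrow> real \<Rightarrow> real set \<Rightarrow> (real \<Rightarrow> 'a::real_normed_field) \<Rightarrow> real \<Rightarrow> ennreal" where
  "lorentz_density s q I f t = ennreal (t powr (s - 1)) * epowr (decr_rearr I f t) q"

definition lorentz_modular ::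
  "real \<Rightarrow> real \<Rightarrow> real set \<Rightarrow> (real \<Rightarrow> 'a::real_normed_field) \<Rightarrow> ennreal" where
  "lorentz_modular s q I f = (\<integral>\<^sup>+t\<in>{0<..}. lorentz_density s q I f t \<partial>lborel)"

lemma borel_measurable_lorentz_density [measurable]:
  "lorentz_density s q I f \<in> borel_measurable borel"
  unfolding lorentz_density_def by measurable

lemma lorentz_norm_eq:
  assumes "0 < p" "0 < q"
  shows "lorentz_norm p q I f = epowr (lorentz_modular (q / p) q I f) (1 / q)"
proof -
  have "epowr (ennreal (t powr (1 / p)) * decr_rearr I f t) q * ennreal (1 / t) * indicator {0<..} t
      = lorentz_density (q / p) q I f t * indicator {0<..} t" for t
  proof (cases "0 < t")
    case True
    have "t powr (q / p) * (1 / t) = t powr (q / p - 1)"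
      using True by (simp add: powr_diff)
    then have "ennreal (t powr (q / p)) * ennreal (1 / t) = ennreal (t powr (q / p - 1))"
      using True by (simp flip: ennreal_mult)
    then show ?thesis
      using True by (simp add: lorentz_density_def epowr_mult_ennreal powr_powr)
         (metis mult.assoc mult.commute)
  qed simp
  then show ?thesis
    by (simp add: lorentz_norm_def lorentz_modular_def)
qed

section \<open>Heads and tails of the modular of one function\<close>

lemma nn_integral_powr_from_0:
  assumes "0 < s" "0 \<le> c"
  shows "(\<integral>\<^sup>+t\<in>{0<..c}. ennreal (t powr (s - 1)) \<partial>lborel) = ennreal (c powr s / s)"
proof -
  have "((\<lambda>t. t powr (s - 1)) has_integral (c powr s / s)) {0..c}"
    using has_integral_powr_from_0[of "s - 1" c] assms by simp
  then have "(\<integral>\<^sup>+t\<in>{0..c}. ennreal (t powr (s - 1)) \<partial>lborel) = ennreal (c powr s / s)"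
    by (intro nn_integral_has_integral_lebesgue') auto
  \<comment> \<open>The endpoint does no harm even pointwise, since \<open>0 powr (s - 1)\<close> is
    0 by convention.\<close>
  moreover have "ennreal (t powr (s - 1)) * indicator {0..c} t
      = ennreal (t powr (s - 1)) * indicator {0<..c} t" for t
    by (cases "t = 0") (auto simp: indicator_def)
  ultimately show ?thesis by simp
qed

lemma lorentz_modular_split:
  assumes "0 < \<eta>"
  shows "lorentz_modular s q I f =
    (\<integral>\<^sup>+t\<in>{0<..\<eta>}. lorentz_density s q I f t \<partial>lborel) + (\<integral>\<^sup>+t\<in>{\<eta><..}. lorentz_density s q I f t \<partial>lborel)"
proof -
  have "lorentz_density s q I f t * indicator {0<..} t =
      lorentz_density s q I f t * indicator {0<..\<eta>} t + lorentz_density s q I f t * indicator {\<eta><..} t" for t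
    using assms by (auto simp: indicator_def)
  then show ?thesis
    by (simp add: lorentz_modular_def nn_integral_add)
qed

text \<open>A Chebyshev bound: on \<open>{0<..t}\<close> the rearrangement is at least its value at
  \<open>t\<close>, and the weight integrates there to \<open>t powr s / s\<close>.\<close>

lemma lorentz_modular_ge:
  assumes "0 < s" "0 < q" "0 < t"
  shows "ennreal (t powr s / s) * epowr (decr_rearr I f t) q \<le> lorentz_modular s q I f"
proof -
  have "ennreal (t powr s / s) * epowr (decr_rearr I f t) q =
      (\<integral>\<^sup>+u. ennreal (u powr (s - 1)) * indicator {0<..t} u * epowr (decr_rearr I f t) q \<partial>lborel)"
    using assms by (simp add: nn_integral_powr_from_0 nn_integral_multc)
  also have "\<dots> \<le> lorentz_modular s q I f"
    unfolding lorentz_modular_def lorentz_density_def using assms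
    by (intro nn_integral_mono)
       (auto simp: indicator_def intro!: mult_left_mono epowr_mono decr_rearr_antimono)
  finally show ?thesis .
qed

text \<open>Beyond 1 the rearrangement vanishes because \<open>I\<close> has measure at most 1;
  between \<eta> and 1 it is at most its value at \<eta>, and the weight has integral
  \<open>1 / s\<close> over \<open>{0<..1}\<close>.\<close>

lemma lorentz_modular_tail_le:
  assumes I: "I \<in> sets lebesgue" "emeasure lebesgue I \<le> 1" and "0 < s" "0 < q" "0 < \<eta>"
  shows "(\<integral>\<^sup>+t\<in>{\<eta><..}. lorentz_density s q I f t \<partial>lborel) \<le> ennreal (1 / s) * epowr (decr_rearr I f \<eta>) q"
proof -
  have "(\<integral>\<^sup>+t\<in>{\<eta><..}. lorentz_density s q I f t \<partial>lborel) \<le>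
     (\<integral>\<^sup>+t. ennreal (t powr (s - 1)) * indicator {0<..1} t * epowr (decr_rearr I f \<eta>) q \<partial>lborel)"
  proof (intro nn_integral_mono)
    fix t :: real
    show "lorentz_density s q I f t * indicator {\<eta><..} t \<le>
        ennreal (t powr (s - 1)) * indicator {0<..1} t * epowr (decr_rearr I f \<eta>) q"
    proof (cases "1 < t")
      case True
      have "decr_rearr I f t = 0"
        using True I by (intro decr_rearr_eq_0) (auto elim!: order_trans)
      then show ?thesis by (simp add: lorentz_density_def)
    next
      case False
      then show ?thesis
        using assms by (auto simp: indicator_def lorentz_density_def
            intro!: mult_left_mono epowr_mono decr_rearr_antimono)
    qed
  qed
  also have "\<dots> = ennreal (1 / s) * epowr (decr_rearr I f \<eta>) q"
    using nn_integral_powr_from_0[of s 1] assms by (simp add: nn_integral_multc)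
  finally show ?thesis .
qed

text \<open>Absolute continuity of a finite integral, by monotone convergence of the truncations to
  \<open>{0<..2 / Suc n}\<close>. The head ends at \<open>2 * \<eta>\<close> because subadditivity
  of rearrangements will cost a doubling of the argument.\<close>

lemma lorentz_modular_head_small:
  assumes "lorentz_modular s q I f < \<infinity>" "0 < \<epsilon>"
  obtains \<eta> where "0 < \<eta>" "(\<integral>\<^sup>+t\<in>{0<..2 * \<eta>}. lorentz_density s q I f t \<partial>lborel) < ennreal \<epsilon>"
proof -
  let ?u = "\<lambda>n t. lorentz_density s q I f t * indicator {0<..2 / Suc n} t"
  have "(INF n. ?u n t) = 0" for t
  proof (cases "0 < t")
    case True
    obtain n where "2 / t < real n" using reals_Archimedean2 by blast
    then have "2 / Suc n < t" using True by (simp add: field_simps)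
    then have "?u n t = 0" by simp
    then show ?thesis
      by (metis (mono_tags, lifting) INF_lower UNIV_I le_zero_eq)
  qed (simp add: indicator_def)
  moreover have "decseq ?u"
    by (intro decseq_SucI le_funI mult_left_mono)
       (auto simp: indicator_def field_simps split: if_splits)
  moreover have "integral\<^sup>N lborel (?u 0) < \<infinity>"
  proof -
    have "integral\<^sup>N lborel (?u 0) \<le> lorentz_modular s q I f"
      unfolding lorentz_modular_def by (intro nn_integral_mono) (auto simp: indicator_def)
    then show ?thesis using assms(1) by (rule le_less_trans)
  qed
  ultimately have "(INF n. integral\<^sup>N lborel (?u n)) = 0"
    using nn_integral_monotone_convergence_INF_decseq[of ?u lborel 0] by simp
  then have "(INF n. integral\<^sup>N lborel (?u n)) < ennreal \<epsilon>"
    using assms(2) by simp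
  then obtain n where "integral\<^sup>N lborel (?u n) < ennreal \<epsilon>"
    by (auto simp: INF_less_iff)
  then show ?thesis
    using that[of "1 / Suc n"] by simp
qed

text \<open>Apply subadditivity to \<open>g = (g + f) - f\<close> at the arguments \<open>t\<close>
  and \<eta>, after translating the domain by \<eta>. Since \<open>s \<le> 1\<close> the weight does
  not increase under this translation, and since \<open>q \<le> 1\<close> the power \<open>q\<close>
  splits over the sum.\<close>

lemma lorentz_modular_add_tail:
  fixes f g :: "real \<Rightarrow> 'a::{real_normed_field, second_countable_topology}"
  assumes I: "I \<in> sets lebesgue" "emeasure lebesgue I \<le> 1"
    and f: "f \<in> borel_measurable (lebesgue_on I)" and g: "g \<in> borel_measurable (lebesgue_on I)"
    and s: "0 < s" "s \<le> 1" and q: "0 < q" "q \<le> 1" and \<eta>: "0 < \<eta>"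
  shows "(\<integral>\<^sup>+t\<in>{2 * \<eta><..}. lorentz_density s q I g t \<partial>lborel) \<le>
    (\<integral>\<^sup>+t\<in>{\<eta><..}. lorentz_density s q I (\<lambda>x. g x + f x) t \<partial>lborel)
      + ennreal (1 / s) * epowr (decr_rearr I f \<eta>) q"
proof -
  let ?h = "\<lambda>x. g x + f x"
  have h: "?h \<in> borel_measurable (lebesgue_on I)" using f g by simp
  have "(\<integral>\<^sup>+t\<in>{2 * \<eta><..}. lorentz_density s q I g t \<partial>lborel) =
      (\<integral>\<^sup>+t. lorentz_density s q I g (\<eta> + 1 * t) * indicator {2 * \<eta><..} (\<eta> + 1 * t) \<partial>lborel)"
    by (subst nn_integral_real_affine[where c = 1 and t = \<eta>]) simp_all
  also have "\<dots> \<le> (\<integral>\<^sup>+t. lorentz_density s q I ?h t * indicator {\<eta><..} t +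
      ennreal (t powr (s - 1)) * indicator {0<..1} t * epowr (decr_rearr I f \<eta>) q \<partial>lborel)"
  proof (intro nn_integral_mono)
    fix t :: real
    show "lorentz_density s q I g (\<eta> + 1 * t) * indicator {2 * \<eta><..} (\<eta> + 1 * t) \<le>
      lorentz_density s q I ?h t * indicator {\<eta><..} t +
      ennreal (t powr (s - 1)) * indicator {0<..1} t * epowr (decr_rearr I f \<eta>) q"
    proof (cases "\<eta> < t \<and> t \<le> 1")
      case True
      have "decr_rearr I (\<lambda>x. ?h x + - f x) (t + \<eta>) \<le> decr_rearr I ?h t + decr_rearr I (\<lambda>x. - f x) \<eta>"
        using True \<eta> h f by (intro decr_rearr_add I) auto
      then have "epowr (decr_rearr I g (\<eta> + t)) q \<le> epowr (decr_rearr I ?h t + decr_rearr I f \<eta>) q"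
        using q by (intro epowr_mono) (auto simp: add.commute)
      also have "\<dots> \<le> epowr (decr_rearr I ?h t) q + epowr (decr_rearr I f \<eta>) q"
        using q by (rule epowr_add_le)
      finally have "ennreal ((\<eta> + t) powr (s - 1)) * epowr (decr_rearr I g (\<eta> + t)) q \<le>
          ennreal (t powr (s - 1)) * (epowr (decr_rearr I ?h t) q + epowr (decr_rearr I f \<eta>) q)"
        using True \<eta> s by (intro mult_mono ennreal_leI powr_mono2') auto
      then show ?thesis
        using True \<eta> by (simp add: lorentz_density_def distrib_left)
    next
      case False
      have "decr_rearr I g (\<eta> + t) = 0" if "1 < t"
        using that \<eta> I
        by (intro decr_rearr_eq_0) (auto elim!: order_trans simp del: ennreal_plus)
      then show ?thesis
        using False by (auto simp: lorentz_density_def indicator_def)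
    qed
  qed
  also have "\<dots> = (\<integral>\<^sup>+t\<in>{\<eta><..}. lorentz_density s q I ?h t \<partial>lborel)
      + ennreal (1 / s) * epowr (decr_rearr I f \<eta>) q"
    using nn_integral_powr_from_0[of s 1] s by (simp add: nn_integral_add nn_integral_multc)
  finally show ?thesis .
qed

text \<open>Apply subadditivity to \<open>f = (g + f) - g\<close> with the argument
  \<open>2 * t\<close> split into equal halves. Substituting \<open>2 * t\<close> for the variable
  multiplies the weight by \<open>2 powr s\<close> in all, which the factor on the left
  cancels.\<close>

lemma lorentz_modular_add_head:
  fixes f g :: "real \<Rightarrow> 'a::{real_normed_field, second_countable_topology}"
  assumes I: "I \<in> sets lebesgue"
    and f: "f \<in> borel_measurable (lebesgue_on I)" and g: "g \<in> borel_measurable (lebesgue_on I)"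
    and q: "0 < q" "q \<le> 1" and \<eta>: "0 < \<eta>"
  shows "ennreal (2 powr - s) * (\<integral>\<^sup>+t\<in>{0<..2 * \<eta>}. lorentz_density s q I f t \<partial>lborel) \<le>
    (\<integral>\<^sup>+t\<in>{0<..\<eta>}. lorentz_density s q I (\<lambda>x. g x + f x) t \<partial>lborel)
      + (\<integral>\<^sup>+t\<in>{0<..\<eta>}. lorentz_density s q I g t \<partial>lborel)"
proof -
  let ?h = "\<lambda>x. g x + f x"
  have h: "?h \<in> borel_measurable (lebesgue_on I)" using f g by simp
  have "ennreal (2 powr - s) * (\<integral>\<^sup>+t\<in>{0<..2 * \<eta>}. lorentz_density s q I f t \<partial>lborel) =
      ennreal (2 powr - s) * (ennreal 2 *
        (\<integral>\<^sup>+t. lorentz_density s q I f (2 * t) * indicator {0<..2 * \<eta>} (2 * t) \<partial>lborel))"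
    by (subst nn_integral_real_affine[where c = 2 and t = 0]) simp_all
  also have "\<dots> = (\<integral>\<^sup>+t. ennreal (2 powr - s * 2) *
      (lorentz_density s q I f (2 * t) * indicator {0<..2 * \<eta>} (2 * t)) \<partial>lborel)"
    by (subst nn_integral_cmult) (simp_all add: ennreal_mult mult.assoc)
  also have "\<dots> \<le> (\<integral>\<^sup>+t. lorentz_density s q I ?h t * indicator {0<..\<eta>} t +
      lorentz_density s q I g t * indicator {0<..\<eta>} t \<partial>lborel)"
  proof (intro nn_integral_mono)
    fix t :: real
    show "ennreal (2 powr - s * 2) * (lorentz_density s q I f (2 * t) * indicator {0<..2 * \<eta>} (2 * t)) \<le>
      lorentz_density s q I ?h t * indicator {0<..\<eta>} t + lorentz_density s q I g t * indicator {0<..\<eta>} t"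
    proof (cases "0 < t \<and> t \<le> \<eta>")
      case True
      have eq: "2 powr - s * 2 * (2 * t) powr (s - 1) = t powr (s - 1)"
        using True by (simp add: powr_mult powr_diff powr_minus)
      have "decr_rearr I (\<lambda>x. ?h x + - g x) (t + t) \<le> decr_rearr I ?h t + decr_rearr I (\<lambda>x. - g x) t"
        using True h g by (intro decr_rearr_add I) auto
      then have "epowr (decr_rearr I f (2 * t)) q \<le> epowr (decr_rearr I ?h t + decr_rearr I g t) q"
        using q by (intro epowr_mono) auto
      also have "\<dots> \<le> epowr (decr_rearr I ?h t) q + epowr (decr_rearr I g t) q"
        using q by (rule epowr_add_le)
      finally have "ennreal (t powr (s - 1)) * epowr (decr_rearr I f (2 * t)) q \<le>
          ennreal (t powr (s - 1)) * (epowr (decr_rearr I ?h t) q + epowr (decr_rearr I g t) q)"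
        by (rule mult_left_mono) simp
      moreover have "ennreal (2 powr - s * 2) * lorentz_density s q I f (2 * t) =
          ennreal (t powr (s - 1)) * epowr (decr_rearr I f (2 * t)) q"
        unfolding lorentz_density_def mult.assoc[symmetric]
        by (subst ennreal_mult[symmetric]) (simp_all only: eq, simp_all)
      ultimately show ?thesis
        using True by (simp add: lorentz_density_def distrib_left)
    qed (auto simp: indicator_def)
  qed
  also have "\<dots> = (\<integral>\<^sup>+t\<in>{0<..\<eta>}. lorentz_density s q I ?h t \<partial>lborel)
      + (\<integral>\<^sup>+t\<in>{0<..\<eta>}. lorentz_density s q I g t \<partial>lborel)"
    by (simp add: nn_integral_add)
  finally show ?thesis .
qed

text \<open>The part of the integral over \<open>(0, \<eta>]\<close> carries almost all of \<open>f\<close>, the part over \<open>(\<eta>, 1)\<close>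
  almost all of \<open>g\<close>; the last two summands on the right are the errors.\<close>

lemma lorentz_modular_add_ge:
  fixes f g :: "real \<Rightarrow> 'a::{real_normed_field, second_countable_topology}"
  assumes I: "I \<in> sets lebesgue" "emeasure lebesgue I \<le> 1"
    and f: "f \<in> borel_measurable (lebesgue_on I)" and g: "g \<in> borel_measurable (lebesgue_on I)"
    and s: "0 < s" "s \<le> 1" and q: "0 < q" "q \<le> 1" and \<eta>: "0 < \<eta>"
  shows "lorentz_modular s q I g + ennreal (2 powr - s) * lorentz_modular s q I f \<le>
    lorentz_modular s q I (\<lambda>x. g x + f x)
      + 2 * (\<integral>\<^sup>+t\<in>{0<..2 * \<eta>}. lorentz_density s q I g t \<partial>lborel)
      + ennreal (2 / s) * epowr (decr_rearr I f \<eta>) q"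
proof -
  let ?h = "\<lambda>x. g x + f x"
  let ?G = "\<integral>\<^sup>+t\<in>{0<..2 * \<eta>}. lorentz_density s q I g t \<partial>lborel"
  let ?E = "ennreal (1 / s) * epowr (decr_rearr I f \<eta>) q"
  have Gle: "(\<integral>\<^sup>+t\<in>{0<..\<eta>}. lorentz_density s q I g t \<partial>lborel) \<le> ?G"
    using \<eta> by (intro nn_integral_mono) (auto simp: indicator_def)
  \<comment> \<open>The head estimate only recovers \<open>f\<close> up to
    \<open>2 * \<eta>\<close>; the rest of its modular is absorbed by the error
    \<open>?E\<close>.\<close>
  have "ennreal (2 powr - s) * (\<integral>\<^sup>+t\<in>{2 * \<eta><..}. lorentz_density s q I f t \<partial>lborel) \<le> 1 * ?E"
  proof (rule mult_mono)
    have "2 powr - s \<le> (2::real) powr 0"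
      using s by (intro powr_mono) auto
    then show "ennreal (2 powr - s) \<le> 1" by simp
    have "(\<integral>\<^sup>+t\<in>{2 * \<eta><..}. lorentz_density s q I f t \<partial>lborel) \<le>
        ennreal (1 / s) * epowr (decr_rearr I f (2 * \<eta>)) q"
      using s q \<eta> by (intro lorentz_modular_tail_le I) simp_all
    also have "\<dots> \<le> ?E"
      using \<eta> q by (intro mult_left_mono epowr_mono decr_rearr_antimono) auto
    finally show "(\<integral>\<^sup>+t\<in>{2 * \<eta><..}. lorentz_density s q I f t \<partial>lborel) \<le> ?E" .
  qed auto
  then have "ennreal (2 powr - s) * lorentz_modular s q I f \<le>
     (\<integral>\<^sup>+t\<in>{0<..\<eta>}. lorentz_density s q I ?h t \<partial>lborel) + ?G + ?E"
    using lorentz_modular_add_head[OF I(1) f g q \<eta>, of s] Gle \<eta>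
    by (subst lorentz_modular_split[of "2 * \<eta>"])
       (auto simp: distrib_left intro!: add_mono elim!: order_trans)
  moreover have "lorentz_modular s q I g \<le>
     ?G + ((\<integral>\<^sup>+t\<in>{\<eta><..}. lorentz_density s q I ?h t \<partial>lborel) + ?E)"
    using lorentz_modular_add_tail[OF I f g s q \<eta>] \<eta>
    by (subst lorentz_modular_split[of "2 * \<eta>"]) (auto intro!: add_mono)
  ultimately have "lorentz_modular s q I g + ennreal (2 powr - s) * lorentz_modular s q I f \<le>
     (?G + ((\<integral>\<^sup>+t\<in>{\<eta><..}. lorentz_density s q I ?h t \<partial>lborel) + ?E)) +
     ((\<integral>\<^sup>+t\<in>{0<..\<eta>}. lorentz_density s q I ?h t \<partial>lborel) + ?G + ?E)"
    by (intro add_mono)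
  also have "\<dots> = lorentz_modular s q I ?h + 2 * ?G + 2 * ?E"
  proof -
    have "(G + (B + E)) + (A + G + E) = (A + B) + 2 * G + 2 * E" for A B G E :: ennreal
      by (simp add: mult_2 add_ac)
    then show ?thesis
      unfolding lorentz_modular_split[OF \<eta>, of _ _ _ ?h] .
  qed
  also have "2 * ?E = ennreal (2 / s) * epowr (decr_rearr I f \<eta>) q"
    using s ennreal_mult[of 2 "1 / s"] by (simp add: mult.assoc[symmetric])
  finally show ?thesis .
qed

section \<open>The square integral\<close>

text \<open>The weak type bound contained in the Lorentz bound, read off from
  \<open>lorentz_modular_ge\<close>. The hypothesis carries the factor \<open>1 / (q / p)\<close> so
  that the resulting constant is exactly \<open>A\<close>.\<close>

lemma decr_rearr_le_of_modular:
  assumes "0 < p" "0 < q" "0 < A" "0 < t"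
    and W: "lorentz_modular (q / p) q I f \<le> ennreal (A powr q / (q / p))"
  shows "decr_rearr I f t \<le> ennreal (A * t powr (- 1 / p))"
proof -
  let ?s = "q / p"
  have s: "0 < ?s" using assms by simp
  have "epowr (decr_rearr I f t) q =
      ennreal (?s * t powr - ?s) * (ennreal (t powr ?s / ?s) * epowr (decr_rearr I f t) q)"
    using assms s by (simp add: mult.assoc[symmetric] powr_minus flip: ennreal_mult)
  also have "\<dots> \<le> ennreal (?s * t powr - ?s) * ennreal (A powr q / ?s)"
    using lorentz_modular_ge[OF s \<open>0 < q\<close> \<open>0 < t\<close>, of I f] W
    by (intro mult_left_mono) (auto elim: order_trans)
  also have "\<dots> = ennreal (A powr q * t powr - ?s)"
    using assms s by (simp flip: ennreal_mult)
  finally have "decr_rearr I f t \<le> ennreal ((A powr q * t powr - ?s) powr (1 / q))"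
    using assms by (subst (asm) epowr_le_iff) auto
  also have "(A powr q * t powr - ?s) powr (1 / q) = A * t powr (- 1 / p)"
    using assms by (simp add: powr_mult powr_powr)
  finally show ?thesis .
qed

text \<open>For \<open>x > B\<close> a single term suffices: if
  \<open>2 ^ k * B < x \<le> 2 ^ Suc k * B\<close>, the square of \<open>x\<close> is at most
  \<open>4 ^ Suc k * B\<^sup>2\<close>.\<close>

lemma power2_le_dyadic_sum:
  fixes x B :: real
  assumes "0 < B" "0 \<le> x"
  shows "ennreal (x\<^sup>2) \<le> ennreal (B\<^sup>2) + (\<Sum>k. ennreal (4 ^ Suc k * B\<^sup>2) * of_bool (2 ^ k * B < x))"
proof (cases "x \<le> B")
  case True
  then have "ennreal (x\<^sup>2) \<le> ennreal (B\<^sup>2)"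
    using assms by (intro ennreal_leI power_mono)
  then show ?thesis by (simp add: add_increasing2)
next
  case False
  obtain m where m: "x / B < 2 ^ m"
    using real_arch_pow[of 2 "x / B"] by auto
  define n where "n = (LEAST n. x \<le> 2 ^ n * B)"
  have "x \<le> 2 ^ m * B" using m assms by (simp add: field_simps)
  then have n: "x \<le> 2 ^ n * B" unfolding n_def by (rule LeastI)
  \<comment> \<open>As \<open>x > B\<close>, the least \<open>n\<close> has a predecessor
    \<open>k\<close>, and minimality gives the lower bound on \<open>x\<close>.\<close>
  with False have "n \<noteq> 0" by (auto intro: Nat.gr0I)
  then obtain k where k: "n = Suc k" by (cases n) auto
  then have less: "2 ^ k * B < x"
    using not_less_Least[of k "\<lambda>n. x \<le> 2 ^ n * B"] by (auto simp: n_def)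
  have "x\<^sup>2 \<le> (2 ^ n * B)\<^sup>2"
    using n assms by (intro power_mono)
  also have "\<dots> = 4 ^ Suc k * B\<^sup>2"
  proof -
    have "(2 ^ k)\<^sup>2 = (4::real) ^ k"
      by (simp add: power2_eq_square flip: power_mult_distrib)
    then show ?thesis by (simp add: k power_mult_distrib)
  qed
  finally have "ennreal (x\<^sup>2) \<le> ennreal (4 ^ Suc k * B\<^sup>2) * of_bool (2 ^ k * B < x)"
    using less by (simp add: ennreal_leI)
  also have "\<dots> \<le> (\<Sum>k. ennreal (4 ^ Suc k * B\<^sup>2) * of_bool (2 ^ k * B < x))"
  proof -
    have "u k \<le> suminf u" for u :: "nat \<Rightarrow> ennreal"
      using sum_le_suminf[of u "{k}"] by simp
    then show ?thesis .
  qed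
  finally show ?thesis by (simp add: add_increasing)
qed

text \<open>A quantitative inclusion into square integrable functions. The weak type bound at
  \<open>t = (2 powr - p) ^ k\<close> bounds the measure of the dyadic level set at
  \<open>2 ^ k * B\<close> by \<open>t\<close>, and the dyadic sum becomes geometric with ratio
  \<open>2 powr (2 - p)\<close>, which is below 1 because \<open>p > 2\<close>.\<close>

lemma nn_integral_square_le:
  fixes f :: "real \<Rightarrow> 'a::real_normed_field"
  assumes "2 < p" "0 < q" "0 < A"
    and I: "I \<in> sets lebesgue" "emeasure lebesgue I \<le> 1" and f: "f \<in> borel_measurable (lebesgue_on I)"
    and W: "lorentz_modular (q / p) q I f \<le> ennreal (A powr q / (q / p))"
  shows "(\<integral>\<^sup>+x. ennreal ((norm (f x))\<^sup>2) \<partial>lebesgue_on I) \<le> ennreal ((4 + 16 / (1 - 2 powr (2 - p))) * A\<^sup>2)"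
proof -
  \<comment> \<open>The factor 2 gives the strict inequality needed for the level sets; it turns
    \<open>B\<^sup>2\<close> and \<open>4 * B\<^sup>2\<close> into the constants 4 and 16.\<close>
  define B where "B = 2 * A"
  define r :: real where "r = 2 powr (2 - p)"
  have r: "0 < r" "r < 1"
    using assms powr_less_mono[of "2 - p" 0 2] by (auto simp: r_def)
  have B: "0 < B" using assms by (simp add: B_def)
  have sp: "space (lebesgue_on I) = I" by (simp add: space_restrict_space)
  have level: "emeasure (lebesgue_on I) {x\<in>I. 2 ^ k * B < norm (f x)} \<le> ennreal ((2 powr - p) ^ k)" for k
  proof -
    define t :: real where "t = (2 powr - p) ^ k"
    have t: "0 < t" by (simp add: t_def)
    have "t powr (- 1 / p) = 2 ^ k"
      using assms by (simp add: t_def powr_powr powr_realpow[symmetric] del: powr_realpow)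
    then have "decr_rearr I f t \<le> ennreal (A * 2 ^ k)"
      using decr_rearr_le_of_modular[OF _ \<open>0 < q\<close> \<open>0 < A\<close> t W] assms by simp
    also have "\<dots> < ennreal (2 ^ k * B)"
      using assms by (intro ennreal_lessI) (auto simp: B_def)
    finally have "emeasure lebesgue {x\<in>I. 2 ^ k * B < norm (f x)} \<le> ennreal t"
      by (rule emeasure_level_le[OF I(1) f])
    then show ?thesis
      unfolding emeasure_lebesgue_on_Collect[OF I(1)] t_def .
  qed
  have mass: "emeasure (lebesgue_on I) I \<le> 1"
    using I emeasure_lebesgue_on_Collect[OF I(1), of "\<lambda>_. True"] by simp
  have [measurable]: "{x\<in>I. 2 ^ k * B < norm (f x)} \<in> sets (lebesgue_on I)" for k
    using sets_level[OF I(1) f] I(1) by (auto simp: sets_restrict_space_iff)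
  have "(\<integral>\<^sup>+x. ennreal ((norm (f x))\<^sup>2) \<partial>lebesgue_on I) \<le>
      (\<integral>\<^sup>+x. ennreal (B\<^sup>2) + (\<Sum>k. ennreal (4 ^ Suc k * B\<^sup>2) * indicator {x\<in>I. 2 ^ k * B < norm (f x)} x) \<partial>lebesgue_on I)"
    using power2_le_dyadic_sum[OF B]
    by (intro nn_integral_mono) (auto simp: sp indicator_def)
  also have "\<dots> = ennreal (B\<^sup>2) * emeasure (lebesgue_on I) I +
      (\<Sum>k. ennreal (4 ^ Suc k * B\<^sup>2) * emeasure (lebesgue_on I) {x\<in>I. 2 ^ k * B < norm (f x)})"
    by (simp add: nn_integral_add nn_integral_suminf nn_integral_cmult_indicator sp)
  also have "\<dots> \<le> ennreal (B\<^sup>2) * 1 + (\<Sum>k. ennreal (4 ^ Suc k * B\<^sup>2) * ennreal ((2 powr - p) ^ k))"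
    using mass level by (intro add_mono mult_left_mono suminf_le) simp_all
  also have "(\<lambda>k. ennreal (4 ^ Suc k * B\<^sup>2) * ennreal ((2 powr - p) ^ k)) = (\<lambda>k. ennreal (4 * B\<^sup>2 * r ^ k))"
  proof
    fix k
    have "r = 4 * 2 powr - p"
      by (simp add: r_def powr_diff powr_minus field_simps)
    then have "4 ^ Suc k * B\<^sup>2 * (2 powr - p) ^ k = 4 * B\<^sup>2 * r ^ k"
      by (simp add: power_mult_distrib)
    moreover have "ennreal (4 ^ Suc k * B\<^sup>2) * ennreal ((2 powr - p) ^ k) = ennreal (4 ^ Suc k * B\<^sup>2 * (2 powr - p) ^ k)"
      by (rule ennreal_mult[symmetric]) auto
    ultimately show "ennreal (4 ^ Suc k * B\<^sup>2) * ennreal ((2 powr - p) ^ k) = ennreal (4 * B\<^sup>2 * r ^ k)"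
      by (simp only:)
  qed
  also have "ennreal (B\<^sup>2) * 1 + (\<Sum>k. ennreal (4 * B\<^sup>2 * r ^ k)) = ennreal (B\<^sup>2 + 4 * B\<^sup>2 * (1 / (1 - r)))"
  proof -
    have "(\<lambda>k. 4 * B\<^sup>2 * r ^ k) sums (4 * B\<^sup>2 * (1 / (1 - r)))"
      using r by (intro sums_mult geometric_sums) auto
    then have "(\<Sum>k. ennreal (4 * B\<^sup>2 * r ^ k)) = ennreal (4 * B\<^sup>2 * (1 / (1 - r)))"
      using r by (intro suminf_ennreal_eq) auto
    then show ?thesis
      using r by (simp only: mult_1_right) (simp flip: ennreal_plus)
  qed
  also have "B\<^sup>2 + 4 * B\<^sup>2 * (1 / (1 - r)) = (4 + 16 / (1 - r)) * A\<^sup>2"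
    by (simp add: B_def power_mult_distrib algebra_simps)
  finally show ?thesis by (simp add: r_def)
qed

text \<open>By the parallelogram law one of the two signs of each new summand does not lose anything, so the
  signs can be chosen one after the other.\<close>

lemma ex_signs_sum_ge:
  fixes f :: "'i \<Rightarrow> 'b \<Rightarrow> 'a::{real_normed_field, euclidean_space}"
  assumes "finite A" and f: "\<And>i. f i \<in> borel_measurable M"
  shows "\<exists>\<epsilon>. (\<forall>i. \<epsilon> i \<in> {1, - 1}) \<and>
    (\<Sum>i\<in>A. \<integral>\<^sup>+x. ennreal ((norm (f i x))\<^sup>2) \<partial>M) \<le> (\<integral>\<^sup>+x. ennreal ((norm (\<Sum>i\<in>A. \<epsilon> i * f i x))\<^sup>2) \<partial>M)"
  using \<open>finite A\<close>
proof induction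
  case empty
  show ?case by (intro exI[of _ "\<lambda>_. 1"]) simp
next
  case (insert a A)
  then obtain \<epsilon> where \<epsilon>: "\<And>i. \<epsilon> i \<in> {1, - 1}" and
    le: "(\<Sum>i\<in>A. \<integral>\<^sup>+x. ennreal ((norm (f i x))\<^sup>2) \<partial>M) \<le> (\<integral>\<^sup>+x. ennreal ((norm (\<Sum>i\<in>A. \<epsilon> i * f i x))\<^sup>2) \<partial>M)"
    by blast
  define g where "g x = (\<Sum>i\<in>A. \<epsilon> i * f i x)" for x
  note [measurable] = f
  have [measurable]: "g \<in> borel_measurable M"
    unfolding g_def by measurable
  define P where "P c = (\<integral>\<^sup>+x. ennreal ((norm (c * f a x + g x))\<^sup>2) \<partial>M)" for c :: 'a
  let ?S = "(\<integral>\<^sup>+x. ennreal ((norm (f a x))\<^sup>2) \<partial>M) + (\<integral>\<^sup>+x. ennreal ((norm (g x))\<^sup>2) \<partial>M)"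
  have "P 1 + P (- 1) = (\<integral>\<^sup>+x. ennreal ((norm (1 * f a x + g x))\<^sup>2) + ennreal ((norm (- 1 * f a x + g x))\<^sup>2) \<partial>M)"
    unfolding P_def by (subst nn_integral_add) measurable
  also have "\<dots> = (\<integral>\<^sup>+x. 2 * (ennreal ((norm (f a x))\<^sup>2) + ennreal ((norm (g x))\<^sup>2)) \<partial>M)"
  proof (intro nn_integral_cong)
    fix x
    let ?w = "(norm (f a x))\<^sup>2 + (norm (g x))\<^sup>2"
    have "(norm (1 * f a x + g x))\<^sup>2 + (norm (- 1 * f a x + g x))\<^sup>2 = 2 * ?w"
      by (simp add: power2_norm_eq_inner inner_add_left inner_add_right inner_diff_left inner_diff_right inner_commute)
    then have "ennreal ((norm (1 * f a x + g x))\<^sup>2) + ennreal ((norm (- 1 * f a x + g x))\<^sup>2) = ennreal (2 * ?w)"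
      by (simp only: ennreal_plus[symmetric] zero_le_power2)
    also have "\<dots> = 2 * (ennreal ((norm (f a x))\<^sup>2) + ennreal ((norm (g x))\<^sup>2))"
      by (subst ennreal_mult) simp_all
    finally show "ennreal ((norm (1 * f a x + g x))\<^sup>2) + ennreal ((norm (- 1 * f a x + g x))\<^sup>2) =
        2 * (ennreal ((norm (f a x))\<^sup>2) + ennreal ((norm (g x))\<^sup>2))" .
  qed
  also have "\<dots> = 2 * ?S"
    by (simp add: nn_integral_cmult nn_integral_add)
  finally have "P 1 + P (- 1) = ?S + ?S"
    by (simp add: mult_2)
  \<comment> \<open>If both values were below \<open>?S\<close>, their sum would be strictly below
    \<open>?S + ?S\<close>.\<close>
  then have "?S \<le> P 1 \<or> ?S \<le> P (- 1)"
    by (metis add_strict_mono linorder_not_le order_less_irrefl)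
  then obtain c where c: "c \<in> {1, - 1}" "?S \<le> P c" by blast
  have sum: "(\<Sum>i\<in>insert a A. (\<epsilon>(a := c)) i * f i x) = c * f a x + g x" for x
  proof -
    have "(\<Sum>i\<in>A. (\<epsilon>(a := c)) i * f i x) = g x"
      unfolding g_def using insert.hyps by (intro sum.cong) auto
    then show ?thesis using insert.hyps by simp
  qed
  have "(\<Sum>i\<in>insert a A. \<integral>\<^sup>+x. ennreal ((norm (f i x))\<^sup>2) \<partial>M) \<le> ?S"
    using le insert.hyps by (simp add: g_def add_left_mono)
  also note c(2)
  finally show ?case
    using \<epsilon> c(1) by (intro exI[of _ "\<epsilon>(a := c)"]) (simp only: sum P_def, auto)
qed


section \<open>Sequences spanning a copy of the unit steps\<close>

text \<open>Since \<open>1 - a > 0\<close>, some \<open>k\<close> has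
  \<open>real k powr (1 - a) > K / c\<close>; multiplying by \<open>real k powr a\<close>
  contradicts the bound.\<close>

lemma linear_not_le_powr:
  fixes a c K :: real
  assumes "a < 1" "0 < c" and le: "\<And>k::nat. 0 < k \<Longrightarrow> c * real k \<le> K * real k powr a"
  shows False
proof -
  \<comment> \<open>The maximum with 1 keeps the base positive, so that \<open>k > 0\<close>
    whatever the sign of \<open>K\<close>.\<close>
  let ?M = "max 1 (K / c)"
  obtain k :: nat where k: "?M powr (1 / (1 - a)) < real k"
    using reals_Archimedean2 by blast
  have "0 < ?M powr (1 / (1 - a))" by simp
  with k have pos: "0 < real k" by linarith
  have "(?M powr (1 / (1 - a))) powr (1 - a) < real k powr (1 - a)"
    using k assms(1) by (intro powr_less_mono2) auto
  then have "K / c < real k powr (1 - a)"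
    using assms(1) by (simp add: powr_powr)
  then have "K * real k powr a < c * (real k powr (1 - a) * real k powr a)"
    using assms(2) pos by (simp add: field_simps)
  also have "real k powr (1 - a) * real k powr a = real k"
    using pos by (simp flip: powr_add)
  finally show False
    using le[of k] pos by simp
qed

text \<open>This is convergence to 0 in measure. Any \<open>k\<close> indices with a large level set
  contribute at least \<open>\<delta>\<^sup>2 * \<eta>\<close> each to the square integral of a
  suitably signed sum, while \<open>upper\<close> and the inclusion in square integrable functions
  bound it by a multiple of \<open>k powr (2 / p)\<close>. As \<open>2 / p < 1\<close>,
  \<open>k\<close> cannot be arbitrarily large.\<close>

lemma finite_large_level:
  fixes f :: "nat \<Rightarrow> real \<Rightarrow> 'a::{real_normed_field, euclidean_space}"
  assumes "2 < p" "0 < q" "0 < D"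
    and I: "I \<in> sets lebesgue" "emeasure lebesgue I \<le> 1"
    and f: "\<And>i. f i \<in> borel_measurable (lebesgue_on I)"
    and upper: "\<And>A \<epsilon>. finite A \<Longrightarrow> (\<And>i. \<epsilon> i \<in> {1, - 1}) \<Longrightarrow>
      lorentz_modular (q / p) q I (\<lambda>x. \<Sum>i\<in>A. \<epsilon> i * f i x) \<le> ennreal (D * real (card A) powr (q / p) / (q / p))"
    and "0 < \<delta>" "0 < \<eta>"
  shows "finite {i. ennreal \<eta> < emeasure lebesgue {x\<in>I. \<delta> < norm (f i x)}}"
proof (rule ccontr)
  let ?S = "{i. ennreal \<eta> < emeasure lebesgue {x\<in>I. \<delta> < norm (f i x)}}"
  define K where "K = (4 + 16 / (1 - 2 powr (2 - p))) * D powr (2 / q)"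
  assume inf: "infinite ?S"
  have "\<delta>\<^sup>2 * \<eta> * real k \<le> K * real k powr (2 / p)" if "0 < k" for k
  proof -
    obtain A where A: "finite A" "card A = k" "A \<subseteq> ?S"
      using infinite_arbitrarily_large[OF inf] by blast
    \<comment> \<open>Chosen so that \<open>upper\<close> is the hypothesis of
      \<open>nn_integral_square_le\<close> with \<open>A = R\<close>.\<close>
    define R where "R = (D * real k powr (q / p)) powr (1 / q)"
    have R: "0 < R" "R powr q = D * real k powr (q / p)"
      using assms that by (auto simp: R_def powr_powr)
    obtain \<epsilon> :: "nat \<Rightarrow> 'a" where \<epsilon>: "\<And>i. \<epsilon> i \<in> {1, - 1}" and
      le: "(\<Sum>i\<in>A. \<integral>\<^sup>+x. ennreal ((norm (f i x))\<^sup>2) \<partial>lebesgue_on I) \<le>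
        (\<integral>\<^sup>+x. ennreal ((norm (\<Sum>i\<in>A. \<epsilon> i * f i x))\<^sup>2) \<partial>lebesgue_on I)"
      using ex_signs_sum_ge[OF A(1), of f "lebesgue_on I", OF f] by blast
    have each: "ennreal (\<delta>\<^sup>2 * \<eta>) \<le> (\<integral>\<^sup>+x. ennreal ((norm (f i x))\<^sup>2) \<partial>lebesgue_on I)" if "i \<in> A" for i
    proof -
      let ?L = "{x\<in>I. \<delta> < norm (f i x)}"
      have L: "?L \<in> sets (lebesgue_on I)"
        using sets_level[OF I(1) f] I(1) by (auto simp: sets_restrict_space_iff)
      have "ennreal \<eta> \<le> emeasure lebesgue ?L"
        by (rule less_imp_le[OF CollectD[OF subsetD[OF A(3) that]]])
      then have "ennreal (\<delta>\<^sup>2) * ennreal \<eta> \<le> ennreal (\<delta>\<^sup>2) * emeasure lebesgue ?L"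
        by (rule mult_left_mono) (rule zero_le)
      then have "ennreal (\<delta>\<^sup>2 * \<eta>) \<le> ennreal (\<delta>\<^sup>2) * emeasure lebesgue ?L"
        using \<open>0 < \<eta>\<close> by (simp only: ennreal_mult zero_le_power2 less_imp_le)
      also have "\<dots> = ennreal (\<delta>\<^sup>2) * emeasure (lebesgue_on I) ?L"
        by (simp only: emeasure_lebesgue_on_Collect[OF I(1)])
      also have "\<dots> = (\<integral>\<^sup>+x. ennreal (\<delta>\<^sup>2) * indicator ?L x \<partial>lebesgue_on I)"
        using L by (simp add: nn_integral_cmult_indicator)
      also have "\<dots> \<le> (\<integral>\<^sup>+x. ennreal ((norm (f i x))\<^sup>2) \<partial>lebesgue_on I)"
        using \<open>0 < \<delta>\<close> by (intro nn_integral_mono) (auto simp: indicator_def intro!: ennreal_leI power_mono)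
      finally show ?thesis .
    qed
    have "ennreal (\<delta>\<^sup>2 * \<eta> * real k) = (\<Sum>i\<in>A. ennreal (\<delta>\<^sup>2 * \<eta>))"
      using A(2) \<open>0 < \<eta>\<close> by (subst sum_ennreal) (simp_all add: mult.commute)
    also have "\<dots> \<le> (\<Sum>i\<in>A. \<integral>\<^sup>+x. ennreal ((norm (f i x))\<^sup>2) \<partial>lebesgue_on I)"
      by (intro sum_mono each)
    also note le
    also have "(\<integral>\<^sup>+x. ennreal ((norm (\<Sum>i\<in>A. \<epsilon> i * f i x))\<^sup>2) \<partial>lebesgue_on I)
        \<le> ennreal ((4 + 16 / (1 - 2 powr (2 - p))) * R\<^sup>2)"
    proof (rule nn_integral_square_le[OF \<open>2 < p\<close> \<open>0 < q\<close> R(1) I])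
      show "(\<lambda>x. \<Sum>i\<in>A. \<epsilon> i * f i x) \<in> borel_measurable (lebesgue_on I)"
        using f by measurable
      show "lorentz_modular (q / p) q I (\<lambda>x. \<Sum>i\<in>A. \<epsilon> i * f i x) \<le> ennreal (R powr q / (q / p))"
        using upper[OF A(1) \<epsilon>] A(2) by (simp add: R(2))
    qed
    also have "R\<^sup>2 = D powr (2 / q) * real k powr (2 / p)"
      using assms R(1) by (simp add: R_def powr_mult powr_powr flip: powr_numeral)
    finally have "ennreal (\<delta>\<^sup>2 * \<eta> * real k) \<le> ennreal (K * real k powr (2 / p))"
      by (simp add: K_def mult.assoc)
    moreover have "0 \<le> K"
      using assms powr_less_mono[of "2 - p" 0 2] by (simp add: K_def)
    ultimately show ?thesis
      by (subst (asm) ennreal_le_iff) auto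
  qed
  then show False
    using assms by (intro linear_not_le_powr[of "2 / p" "\<delta>\<^sup>2 * \<eta>" K]) auto
qed

text \<open>Indices are picked one at a time so that each raises the modular of the sum by at least
  \<open>d\<close>. The modular then grows linearly in the number of terms, against the bound of
  order \<open>s < 1\<close> in \<open>upper\<close>.\<close>

lemma no_lorentz_sequence:
  fixes f :: "nat \<Rightarrow> real \<Rightarrow> 'a::{real_normed_field, euclidean_space}"
  assumes p: "2 < p" and q: "0 < q" "q \<le> 1" and D: "0 < D"
    and I: "I \<in> sets lebesgue" "emeasure lebesgue I \<le> 1"
    and f: "\<And>i. f i \<in> borel_measurable (lebesgue_on I)"
    and upper: "\<And>A \<epsilon>. finite A \<Longrightarrow> (\<And>i. \<epsilon> i \<in> {1, - 1}) \<Longrightarrow>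
      lorentz_modular (q / p) q I (\<lambda>x. \<Sum>i\<in>A. \<epsilon> i * f i x) \<le> ennreal (D * real (card A) powr (q / p) / (q / p))"
    and c: "0 < c" and lower: "\<And>i. ennreal c \<le> lorentz_modular (q / p) q I (f i)"
  shows False
proof -
  define s where "s = q / p"
  have s: "0 < s" "s < 1" using p q by (auto simp: s_def)
  \<comment> \<open>A new term is worth at least \<open>2 powr - s * c = 2 * d\<close>; one
    \<open>d\<close> is kept as the gain and the other pays for the errors.\<close>
  define d where "d = 2 powr - s * c / 2"
  have d: "0 < d" using c by (simp add: d_def)
  \<comment> \<open>This makes the error \<open>2 / s * \<delta> powr q\<close> equal to
    \<open>d / 2\<close>; twice the head of \<open>g\<close>, itself below \<open>d / 4\<close>,
    accounts for the other half.\<close>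
  define \<delta> where "\<delta> = (s * d / 4) powr (1 / q)"
  have \<delta>: "0 < \<delta>" "\<delta> powr q = s * d / 4"
    using s d q by (auto simp: \<delta>_def powr_powr)
  have up: "lorentz_modular s q I (\<lambda>x. \<Sum>i\<in>A. f i x) \<le> ennreal (D * real (card A) powr s / s)"
    if "finite A" for A
    using upper[OF that, of "\<lambda>_. 1"] by (simp add: s_def)
  have ex: "\<exists>A. finite A \<and> card A = N \<and> ennreal (d * real N) \<le> lorentz_modular s q I (\<lambda>x. \<Sum>i\<in>A. f i x)" for N
  proof (induction N)
    case 0
    then show ?case by (intro exI[of _ "{}"]) simp
  next
    case (Suc N)
    then obtain A where A: "finite A" "card A = N"
      "ennreal (d * real N) \<le> lorentz_modular s q I (\<lambda>x. \<Sum>i\<in>A. f i x)" by blast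
    define g where "g x = (\<Sum>i\<in>A. f i x)" for x
    have g: "g \<in> borel_measurable (lebesgue_on I)"
      unfolding g_def using f by measurable
    have "lorentz_modular s q I g < \<infinity>"
      using up[OF A(1)] by (simp add: g_def[abs_def] le_less_trans)
    then obtain \<eta> where \<eta>: "0 < \<eta>"
      "(\<integral>\<^sup>+t\<in>{0<..2 * \<eta>}. lorentz_density s q I g t \<partial>lborel) < ennreal (d / 4)"
      using lorentz_modular_head_small[of s q I g "d / 4"] d by auto
    \<comment> \<open>With \<eta> already fixed by \<open>g\<close>, only finitely many indices are
      used up or too large in measure, so a fresh admissible one exists.\<close>
    have "finite (A \<union> {i. ennreal \<eta> < emeasure lebesgue {x\<in>I. \<delta> < norm (f i x)}})"
      by (rule finite_UnI[OF A(1) finite_large_level[OF p q(1) D I f upper \<delta>(1) \<eta>(1)]])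
    then obtain i where i: "i \<notin> A" "emeasure lebesgue {x\<in>I. \<delta> < norm (f i x)} \<le> ennreal \<eta>"
      using ex_new_if_finite[OF infinite_UNIV_nat] by (metis (no_types, lifting) UnCI mem_Collect_eq not_le)
    have "epowr (decr_rearr I (f i) \<eta>) q \<le> epowr (ennreal \<delta>) q"
      using q \<delta> i by (intro epowr_mono decr_rearr_le) auto
    then have small: "ennreal (2 / s) * epowr (decr_rearr I (f i) \<eta>) q \<le> ennreal (2 / s) * ennreal (s * d / 4)"
      using \<delta> by (intro mult_left_mono) (auto simp: epowr_ennreal)
    have "ennreal (d * real N) + ennreal (2 * d) \<le>
        lorentz_modular s q I g + ennreal (2 powr - s) * lorentz_modular s q I (f i)"
    proof (rule add_mono)
      have "ennreal (2 * d) = ennreal (2 powr - s) * ennreal c"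
        using c by (subst ennreal_mult[symmetric]) (auto simp: d_def)
      also have "\<dots> \<le> ennreal (2 powr - s) * lorentz_modular s q I (f i)"
        using lower[of i] by (intro mult_left_mono) (auto simp: s_def)
      finally show "ennreal (2 * d) \<le> ennreal (2 powr - s) * lorentz_modular s q I (f i)" .
    qed (use A(3) in \<open>simp add: g_def[abs_def]\<close>)
    also have "\<dots> \<le> lorentz_modular s q I (\<lambda>x. g x + f i x)
      + 2 * (\<integral>\<^sup>+t\<in>{0<..2 * \<eta>}. lorentz_density s q I g t \<partial>lborel)
      + ennreal (2 / s) * epowr (decr_rearr I (f i) \<eta>) q"
      using s by (intro lorentz_modular_add_ge I f g q \<eta>) auto
    also have "\<dots> \<le> lorentz_modular s q I (\<lambda>x. g x + f i x) + ennreal 2 * ennreal (d / 4)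
      + ennreal (2 / s) * ennreal (s * d / 4)"
      using \<eta>(2) by (intro add_mono[OF _ small] add_mono mult_mono) auto
    also have "\<dots> = lorentz_modular s q I (\<lambda>x. g x + f i x) + ennreal d"
    proof -
      have "ennreal 2 * ennreal (d / 4) = ennreal (d / 2)" "ennreal (2 / s) * ennreal (s * d / 4) = ennreal (d / 2)"
        using s d by (subst ennreal_mult[symmetric]; simp)+
      moreover have "ennreal (d / 2) + ennreal (d / 2) = ennreal d"
        using d by (simp flip: ennreal_plus)
      ultimately show ?thesis by (simp only: add.assoc)
    qed
    finally have "ennreal (d * real (Suc N)) + ennreal d \<le> lorentz_modular s q I (\<lambda>x. g x + f i x) + ennreal d"
      using d by (simp add: algebra_simps flip: ennreal_plus)
    then have "ennreal (d * real (Suc N)) \<le> lorentz_modular s q I (\<lambda>x. g x + f i x)"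
      by simp
    moreover have "(\<lambda>x. g x + f i x) = (\<lambda>x. \<Sum>j\<in>insert i A. f j x)"
      using A i by (simp add: g_def add.commute)
    ultimately show ?case
      using A i by (intro exI[of _ "insert i A"]) simp
  qed
  have "d * real k \<le> D / s * real k powr s" if "0 < k" for k
  proof -
    obtain A where A: "finite A" "card A = k"
      "ennreal (d * real k) \<le> lorentz_modular s q I (\<lambda>x. \<Sum>i\<in>A. f i x)" using ex by blast
    then have "ennreal (d * real k) \<le> ennreal (D * real k powr s / s)"
      using order_trans[OF A(3) up[OF A(1)]] by simp
    then show ?thesis
      using D s by (subst (asm) ennreal_le_iff) auto
  qed
  then show False
    by (rule linear_not_le_powr[OF s(2) d])
qed

lemma lorentz_norm_finiteE:
  assumes "0 < p" "0 < q" "lorentz_norm p q I f < \<infinity>"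
  obtains w where "0 \<le> w" "lorentz_modular (q / p) q I f = ennreal w"
    "enn2real (lorentz_norm p q I f) = w powr (1 / q)"
proof (cases "lorentz_modular (q / p) q I f")
  case (real w)
  then show ?thesis
    using assms that by (simp add: lorentz_norm_eq epowr_ennreal)
next
  case top
  then show ?thesis
    using assms by (simp add: lorentz_norm_eq)
qed

section \<open>Unit steps on the half-line\<close>

definition unit_step_sum :: "nat set \<Rightarrow> (nat \<Rightarrow> 'a) \<Rightarrow> real \<Rightarrow> 'a::real_normed_field" where
  "unit_step_sum A \<epsilon> x = (\<Sum>i\<in>A. \<epsilon> i * indicator {real i<..real i + 1} x)"

lemma unit_step_sum_empty: "unit_step_sum {} \<epsilon> x = 0"
  by (simp add: unit_step_sum_def)

lemma unit_step_sum_insert: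
  assumes "finite A" "a \<notin> A"
  shows "unit_step_sum (insert a A) \<epsilon> x = \<epsilon> a * indicator {real a<..real a + 1} x + unit_step_sum A \<epsilon> x"
  unfolding unit_step_sum_def using assms by (rule sum.insert)

lemma borel_measurable_unit_step_sum:
  fixes \<epsilon> :: "nat \<Rightarrow> 'a::{real_normed_field, second_countable_topology}"
  assumes "I \<in> sets lebesgue"
  shows "unit_step_sum A \<epsilon> \<in> borel_measurable (lebesgue_on I)"
proof -
  have "unit_step_sum A \<epsilon> \<in> borel_measurable borel"
    unfolding unit_step_sum_def[abs_def] by measurable
  then show ?thesis
    by (intro measurable_restrict_space1 measurable_completion) simp
qed

text \<open>The half-open steps are pairwise disjoint, so at each point at most one summand
  survives, with a coefficient of norm 1.\<close>

lemma norm_unit_step_sum: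
  assumes A: "finite A" and \<epsilon>: "\<And>i. \<epsilon> i \<in> {1, - 1}"
  shows "norm (unit_step_sum A \<epsilon> x) = indicator (\<Union>i\<in>A. {real i<..real i + 1}) x"
proof (cases "x \<in> (\<Union>i\<in>A. {real i<..real i + 1})")
  case True
  then obtain i where i: "i \<in> A" "x \<in> {real i<..real i + 1}" by blast
  have "x \<notin> {real j<..real j + 1}" if "j \<noteq> i" for j
    using that i(2) by (auto simp: not_less_eq[symmetric] not_le not_less linorder_neq_iff)
  then have "unit_step_sum A \<epsilon> x = (\<Sum>j\<in>A. if j = i then \<epsilon> i else 0)"
    unfolding unit_step_sum_def using i by (intro sum.cong) auto
  then show ?thesis
    using True A i \<epsilon>[of i] by auto
next
  case False
  then have "unit_step_sum A \<epsilon> x = 0"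
    unfolding unit_step_sum_def by (intro sum.neutral) auto
  with False show ?thesis by simp
qed

lemma emeasure_unit_steps:
  assumes "finite A"
  shows "emeasure lebesgue (\<Union>i\<in>A. {real i<..real i + 1}) = ennreal (real (card A))"
proof -
  have "{real i<..real i + 1} \<inter> {real j<..real j + 1} = {}" if "i \<noteq> j" for i j
    using that by (auto simp: linorder_neq_iff)
  then have "disjoint_family_on (\<lambda>i. {real i<..real i + 1}) A"
    by (auto simp: disjoint_family_on_def)
  then have "emeasure lebesgue (\<Union>i\<in>A. {real i<..real i + 1}) = (\<Sum>i\<in>A. emeasure lebesgue {real i<..real i + 1})"
    using assms by (intro sum_emeasure[symmetric]) auto
  also have "\<dots> = ennreal (real (card A))"
    by (simp add: ennreal_of_nat_eq_real_of_nat)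
  finally show ?thesis .
qed

lemma unit_step_level:
  assumes A: "finite A" and \<epsilon>: "\<And>i. \<epsilon> i \<in> {1, - 1}" and "0 < l" "l < 1"
  shows "{x\<in>{0<..}. l < norm (unit_step_sum A \<epsilon> x)} = (\<Union>i\<in>A. {real i<..real i + 1})"
proof -
  let ?U = "\<Union>i\<in>A. {real i<..real i + 1}"
  have pos: "0 < x" if "x \<in> ?U" for x
    using that by (auto intro: le_less_trans[OF of_nat_0_le_iff])
  have "l < indicator ?U x \<longleftrightarrow> x \<in> ?U" for x
    using assms(3,4) by (cases "x \<in> ?U") (simp_all only: indicator_simps, simp_all)
  then have "{x\<in>{0<..}. l < norm (unit_step_sum A \<epsilon> x)} = {x\<in>{0<..}. x \<in> ?U}"
    by (simp only: norm_unit_step_sum[OF A \<epsilon>])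
  then show ?thesis
    using pos by blast
qed

text \<open>The rearrangement is at most 1 and vanishes from \<open>card A\<close> on, the measure
  of the support; what remains is the integral of the weight over
  \<open>{0<..real (card A)}\<close>.\<close>

lemma lorentz_modular_unit_step_sum_le:
  assumes A: "finite A" and \<epsilon>: "\<And>i. \<epsilon> i \<in> {1, - 1}" and s: "0 < s" and q: "0 < q"
  shows "lorentz_modular s q {0<..} (unit_step_sum A \<epsilon>) \<le> ennreal (real (card A) powr s / s)"
proof -
  let ?g = "unit_step_sum A \<epsilon>"
  have le1: "decr_rearr {0<..} ?g t \<le> ennreal 1" for t
  proof (rule decr_rearr_le)
    have "{x\<in>{0<..}. 1 < norm (?g x)} = {}"
      using A \<epsilon> by (auto simp: norm_unit_step_sum indicator_def)
    then show "emeasure lebesgue {x\<in>{0<..}. 1 < norm (?g x)} \<le> ennreal t"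
      by (simp only: emeasure_empty zero_le)
  qed simp
  have eq0: "decr_rearr {0<..} ?g t = 0" if t: "real (card A) \<le> t" for t
  proof -
    have "decr_rearr {0<..} ?g t \<le> 0 + ennreal e" if "0 < e" for e
    proof (cases "e < 1")
      case True
      have "emeasure lebesgue {x\<in>{0<..}. e < norm (?g x)} \<le> ennreal t"
        unfolding unit_step_level[OF A \<epsilon> \<open>0 < e\<close> True] emeasure_unit_steps[OF A]
        using t by (rule ennreal_leI)
      then show ?thesis
        using decr_rearr_le[OF that, of "{0<..}" ?g t] by (simp only: add_0)
    next
      case False
      have "decr_rearr {0<..} ?g t \<le> ennreal 1" by (rule le1)
      also have "\<dots> \<le> ennreal e" using False by (intro ennreal_leI) simp
      finally show ?thesis by simp
    qed
    then have "decr_rearr {0<..} ?g t \<le> 0"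
      by (rule ennreal_le_epsilon)
    then show ?thesis by simp
  qed
  have "lorentz_modular s q {0<..} ?g \<le> (\<integral>\<^sup>+t\<in>{0<..real (card A)}. ennreal (t powr (s - 1)) \<partial>lborel)"
    unfolding lorentz_modular_def lorentz_density_def
  proof (intro nn_integral_mono)
    fix t :: real
    show "ennreal (t powr (s - 1)) * epowr (decr_rearr {0<..} ?g t) q * indicator {0<..} t
       \<le> ennreal (t powr (s - 1)) * indicator {0<..real (card A)} t"
    proof (cases "t \<le> real (card A)")
      case True
      have "epowr (decr_rearr {0<..} ?g t) q \<le> epowr 1 q"
        using le1[of t] q by (intro epowr_mono) auto
      then have "ennreal (t powr (s - 1)) * epowr (decr_rearr {0<..} ?g t) q \<le> ennreal (t powr (s - 1)) * 1"
        by (intro mult_left_mono) auto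
      then show ?thesis using True by (auto simp: indicator_def)
    next
      case False
      then show ?thesis using eq0[of t] by simp
    qed
  qed
  also have "\<dots> = ennreal (real (card A) powr s / s)"
    using s by (intro nn_integral_powr_from_0) auto
  finally show ?thesis .
qed

text \<open>At any argument below 1, here \<open>1 / 2\<close>, the rearrangement of one step is at
  least 1: a smaller level would have a level set of measure 1. The Chebyshev bound does the
  rest.\<close>

lemma lorentz_modular_unit_step_ge:
  assumes \<epsilon>: "\<And>i. \<epsilon> i \<in> {1, - 1}" and s: "0 < s" and q: "0 < q"
  shows "ennreal ((1 / 2) powr s / s) \<le> lorentz_modular s q {0<..} (unit_step_sum {i} \<epsilon>)"
proof -
  let ?g = "unit_step_sum {i} \<epsilon>"
  have "1 \<le> decr_rearr {0<..} ?g (1 / 2)"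
  proof (rule ccontr)
    assume "\<not> ?thesis"
    then have "decr_rearr {0<..} ?g (1 / 2) < ennreal 1" by simp
    then obtain r where r: "0 < r" "r < 1"
      "emeasure lebesgue {x\<in>{0<..}. r < norm (?g x)} \<le> ennreal (1 / 2)"
      by (rule decr_rearr_less)
    have "ennreal (real (card {i})) \<le> ennreal (1 / 2)"
      using r(3) \<epsilon> unfolding unit_step_level[OF finite.insertI[OF finite.emptyI] \<epsilon> r(1,2)]
      by (subst (asm) emeasure_unit_steps) auto
    then show False
      by (subst (asm) ennreal_le_iff) auto
  qed
  then have "epowr 1 q \<le> epowr (decr_rearr {0<..} ?g (1 / 2)) q"
    using q by (intro epowr_mono) auto
  then have "ennreal ((1 / 2) powr s / s) * 1 \<le> ennreal ((1 / 2) powr s / s) * epowr (decr_rearr {0<..} ?g (1 / 2)) q"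
    by (intro mult_left_mono) auto
  also have "\<dots> \<le> lorentz_modular s q {0<..} ?g"
    using s q by (intro lorentz_modular_ge) auto
  finally show ?thesis by simp
qed

text \<open>Representatives of the images of the unit steps form a sequence excluded by
  \<open>no_lorentz_sequence\<close>. The sort of \<open>'a\<close> covers real and complex scalars
  at once, with a norm that comes from an inner product.\<close>

lemma not_embeds_lorentz_space:
  fixes p q :: real
  assumes p: "2 < p" and q: "0 < q" "q \<le> 1"
  shows "\<not> embeds_isomorphically
    (lorentz_space p q {0<..} :: ('a::{real_normed_field, euclidean_space}, (real \<Rightarrow> 'a) set) qn_space)
    (lorentz_space p q {0<..<1} :: ('a, (real \<Rightarrow> 'a) set) qn_space)"
proof
  let ?I = "{0<..} :: real set" and ?J = "{0<..<1} :: real set"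
  let ?X = "lorentz_space p q ?I :: ('a, (real \<Rightarrow> 'a) set) qn_space"
  let ?Y = "lorentz_space p q ?J :: ('a, (real \<Rightarrow> 'a) set) qn_space"
  define s where "s = q / p"
  have s: "0 < s" "0 < p" using p q by (auto simp: s_def)
  have I: "?I \<in> sets lebesgue" and J: "?J \<in> sets lebesgue" "emeasure lebesgue ?J \<le> 1" by auto
  note meas = borel_measurable_unit_step_sum[OF I, where ?'a = 'a]
  assume "embeds_isomorphically ?X ?Y"
  then obtain T C where lin: "linear_map ?X ?Y T" and C: "1 \<le> C"
    and T: "\<And>x. x \<in> vectors ?X \<Longrightarrow> inverse C * qnorm ?X x \<le> qnorm ?Y (T x) \<and> qnorm ?Y (T x) \<le> C * qnorm ?X x"
    unfolding embeds_isomorphically_def isomorphic_embedding_def by blast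
  have vec: "ae_class ?I f \<in> vectors ?X"
    if "f \<in> borel_measurable (lebesgue_on ?I)" "lorentz_norm p q ?I f < \<infinity>" for f
    using that by (simp add: lorentz_space_def)
  have finX: "lorentz_norm p q ?I (unit_step_sum A \<epsilon>) < \<infinity>"
    if "finite A" "\<And>i. \<epsilon> i \<in> {1, - 1}" for A and \<epsilon> :: "nat \<Rightarrow> 'a"
  proof -
    have "lorentz_modular s q ?I (unit_step_sum A \<epsilon>) \<le> ennreal (real (card A) powr s / s)"
      by (intro lorentz_modular_unit_step_sum_le that s(1) q(1))
    also have "\<dots> < \<infinity>" by simp
    finally have "lorentz_modular s q ?I (unit_step_sum A \<epsilon>) < \<infinity>" .
    then show ?thesis
      using s q by (auto simp: lorentz_norm_eq s_def[symmetric] epowr_def)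
  qed
  have vecX: "ae_class ?I (unit_step_sum A \<epsilon>) \<in> vectors ?X"
    if "finite A" "\<And>i. \<epsilon> i \<in> {1, - 1}" for A and \<epsilon> :: "nat \<Rightarrow> 'a"
    using that by (intro vec meas finX)
  let ?e = "\<lambda>i. unit_step_sum {i} (\<lambda>_. 1) :: real \<Rightarrow> 'a"
  have "\<exists>f. f \<in> borel_measurable (lebesgue_on ?J) \<and> T (ae_class ?I (?e i)) = ae_class ?J f" for i
  proof -
    have "T (ae_class ?I (?e i)) \<in> vectors ?Y"
      using lin vecX[of "{i}" "\<lambda>_. 1"] by (simp add: linear_map_def)
    then show ?thesis by (auto simp: lorentz_space_def)
  qed
  then obtain f where f: "\<And>i. f i \<in> borel_measurable (lebesgue_on ?J)"
    and Tf: "\<And>i. T (ae_class ?I (?e i)) = ae_class ?J (f i)" by metis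
  have scale: "ae_class ?I (\<lambda>x. c * ?e i x) \<in> vectors ?X \<Longrightarrow> T (ae_class ?I (\<lambda>x. c * ?e i x)) = ae_class ?J (\<lambda>x. c * f i x)" for c i
  proof -
    have "T (vscale ?X c (ae_class ?I (?e i))) = vscale ?Y c (T (ae_class ?I (?e i)))"
      using lin vecX[of "{i}" "\<lambda>_. 1"] by (simp add: linear_map_def)
    then show ?thesis
      by (simp add: vscale_lorentz_space meas f Tf)
  qed
  have Tsum: "T (ae_class ?I (unit_step_sum A \<epsilon>)) = ae_class ?J (\<lambda>x. \<Sum>i\<in>A. \<epsilon> i * f i x)"
    if "finite A" and \<epsilon>: "\<And>i. \<epsilon> i \<in> {1, - 1}" for A \<epsilon>
    using \<open>finite A\<close>
  proof induction
    case empty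
    \<comment> \<open>The zero class is treated as the multiple by 0 of a step, so that homogeneity
      of \<open>T\<close> yields its image.\<close>
    have "(\<lambda>x. 0 * ?e 0 x) = unit_step_sum {} \<epsilon>"
      by (simp add: unit_step_sum_empty fun_eq_iff)
    then show ?case
      using scale[of 0 0] vecX[of "{}" \<epsilon>] \<epsilon> by simp
  next
    case (insert a A)
    have one: "(\<lambda>x. \<epsilon> a * ?e a x) = unit_step_sum {a} \<epsilon>"
      by (simp add: unit_step_sum_insert unit_step_sum_empty fun_eq_iff)
    have ins: "unit_step_sum (insert a A) \<epsilon> = (\<lambda>x. unit_step_sum {a} \<epsilon> x + unit_step_sum A \<epsilon> x)"
      using insert.hyps by (simp add: unit_step_sum_insert unit_step_sum_empty fun_eq_iff)
    have "T (ae_class ?I (unit_step_sum {a} \<epsilon>)) = ae_class ?J (\<lambda>x. \<epsilon> a * f a x)"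
      using scale[of "\<epsilon> a" a] vecX[of "{a}" \<epsilon>] \<epsilon> by (simp add: one)
    moreover have "T (vadd ?X (ae_class ?I (unit_step_sum {a} \<epsilon>)) (ae_class ?I (unit_step_sum A \<epsilon>))) =
       vadd ?Y (T (ae_class ?I (unit_step_sum {a} \<epsilon>))) (T (ae_class ?I (unit_step_sum A \<epsilon>)))"
      using lin vecX[of "{a}" \<epsilon>] vecX[of A \<epsilon>] insert.hyps \<epsilon> by (simp add: linear_map_def)
    moreover have "(\<lambda>x. \<epsilon> a * f a x) \<in> borel_measurable (lebesgue_on ?J)"
      "(\<lambda>x. \<Sum>i\<in>A. \<epsilon> i * f i x) \<in> borel_measurable (lebesgue_on ?J)"
      using f by measurable
    ultimately show ?case
      using insert.hyps by (simp add: ins vadd_lorentz_space meas insert.IH)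
  qed
  \<comment> \<open>Finiteness must be known before \<open>qnorm\<close> says anything about the
    modular, since \<open>enn2real\<close> sends \<infinity> to 0. It passes from some
    representative of the class to every other.\<close>
  have finY: "lorentz_norm p q ?J h < \<infinity>"
    if h: "h \<in> borel_measurable (lebesgue_on ?J)" and hY: "ae_class ?J h \<in> vectors ?Y" for h :: "real \<Rightarrow> 'a"
  proof -
    obtain h' where h': "h' \<in> borel_measurable (lebesgue_on ?J)" "lorentz_norm p q ?J h' < \<infinity>"
      "ae_class ?J h = ae_class ?J h'"
      using hY by (auto simp: lorentz_space_def)
    then have "lorentz_norm p q ?J h = lorentz_norm p q ?J h'"
      using ae_class_eq_iff[OF h] by (intro lorentz_norm_cong_AE[OF J(1) h]) auto
    with h' show ?thesis by simp
  qed
  \<comment> \<open>The two bounds for \<open>T\<close>, raised to the power \<open>q\<close>,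
    compare the modulars up to the factor \<open>C powr q\<close>.\<close>
  have main: "\<exists>u v. lorentz_modular s q ?I (unit_step_sum A \<epsilon>) = ennreal u \<and>
      lorentz_modular s q ?J (\<lambda>x. \<Sum>i\<in>A. \<epsilon> i * f i x) = ennreal v \<and> 0 \<le> u \<and> 0 \<le> v \<and>
      u \<le> C powr q * v \<and> v \<le> C powr q * u"
    if A: "finite A" and \<epsilon>: "\<And>i. \<epsilon> i \<in> {1, - 1}" for A \<epsilon>
  proof -
    let ?F = "\<lambda>x. \<Sum>i\<in>A. \<epsilon> i * f i x"
    have F: "?F \<in> borel_measurable (lebesgue_on ?J)" using f by measurable
    have "T (ae_class ?I (unit_step_sum A \<epsilon>)) \<in> vectors ?Y"
      using lin vecX[of A \<epsilon>, OF A \<epsilon>] unfolding linear_map_def by blast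
    then have finF: "lorentz_norm p q ?J ?F < \<infinity>"
      unfolding Tsum[of A \<epsilon>, OF A \<epsilon>] by (rule finY[OF F])
    obtain v where v: "0 \<le> v" "lorentz_modular s q ?J ?F = ennreal v"
      "enn2real (lorentz_norm p q ?J ?F) = v powr (1 / q)"
      by (rule lorentz_norm_finiteE[OF s(2) q(1) finF, folded s_def])
    obtain u where u: "0 \<le> u" "lorentz_modular s q ?I (unit_step_sum A \<epsilon>) = ennreal u"
      "enn2real (lorentz_norm p q ?I (unit_step_sum A \<epsilon>)) = u powr (1 / q)"
      by (rule lorentz_norm_finiteE[OF s(2) q(1) finX[of A \<epsilon>, OF A \<epsilon>], folded s_def])
    have "inverse C * u powr (1 / q) \<le> v powr (1 / q)" and vu: "v powr (1 / q) \<le> C * u powr (1 / q)"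
      using T[OF vecX[of A \<epsilon>, OF A \<epsilon>]] by (simp_all add: Tsum[of A \<epsilon>, OF A \<epsilon>] qnorm_lorentz_space I J F meas u v)
    then have uv: "u powr (1 / q) \<le> C * v powr (1 / q)"
      using C by (simp add: field_simps)
    have pw: "y \<le> C powr q * z" if "y powr (1 / q) \<le> C * z powr (1 / q)" "0 \<le> y" "0 \<le> z" for y z
    proof -
      have "(y powr (1 / q)) powr q \<le> (C * z powr (1 / q)) powr q"
        using that q by (intro powr_mono2) auto
      then show ?thesis
        using that q C by (simp add: powr_powr powr_mult)
    qed
    show ?thesis
      using pw[OF uv] pw[OF vu] u v by blast
  qed
  have s': "q / p = s" by (simp add: s_def)
  show False
  \<comment> \<open>Both constants are the bounds for unit steps carried through
    \<open>main\<close>: multiplied by \<open>C powr q\<close> from above, divided by it from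
    below.\<close>
  proof (rule no_lorentz_sequence[where D = "C powr q" and c = "(1 / 2) powr s / s / C powr q" and f = f and I = ?J, OF p q _ J f], unfold s')
    fix A :: "nat set" and \<epsilon> :: "nat \<Rightarrow> 'a"
    assume A: "finite A" and \<epsilon>: "\<And>i. \<epsilon> i \<in> {1, - 1}"
    obtain u v where uv: "lorentz_modular s q ?I (unit_step_sum A \<epsilon>) = ennreal u"
      "lorentz_modular s q ?J (\<lambda>x. \<Sum>i\<in>A. \<epsilon> i * f i x) = ennreal v" "0 \<le> u" "v \<le> C powr q * u"
      using main[of A \<epsilon>, OF A \<epsilon>] by blast
    have "u \<le> real (card A) powr s / s"
      using lorentz_modular_unit_step_sum_le[of A \<epsilon> s q, OF A \<epsilon> s(1) q(1)] s uv by simp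
    then have "C powr q * u \<le> C powr q * (real (card A) powr s / s)"
      by (intro mult_left_mono) auto
    with uv show "lorentz_modular s q ?J (\<lambda>x. \<Sum>i\<in>A. \<epsilon> i * f i x) \<le> ennreal (C powr q * real (card A) powr s / s)"
      by (auto intro!: ennreal_leI)
  next
    fix i
    obtain u v where uv: "lorentz_modular s q ?I (unit_step_sum {i} (\<lambda>_. 1 :: 'a)) = ennreal u"
      "lorentz_modular s q ?J (\<lambda>x. \<Sum>i\<in>{i}. 1 * f i x) = ennreal v" "0 \<le> u" "0 \<le> v" "u \<le> C powr q * v"
      using main[of "{i}" "\<lambda>_. 1"] by auto
    have "(1 / 2) powr s / s \<le> u"
      using lorentz_modular_unit_step_ge[of "\<lambda>_. 1 :: 'a" s q i] s q uv by simp
    then have "(1 / 2) powr s / s / C powr q \<le> u / C powr q"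
      by (rule divide_right_mono) simp
    also have "\<dots> \<le> v"
      using uv(5) C by (simp add: pos_divide_le_eq mult.commute)
    finally have "(1 / 2) powr s / s / C powr q \<le> v" .
    then show "ennreal ((1 / 2) powr s / s / C powr q) \<le> lorentz_modular s q ?J (f i)"
      using uv by (simp add: ennreal_leI)
  qed (use C s in auto)
qed

lemma not_isomorphic_if_not_embeds: "\<not> embeds_isomorphically X Y \<Longrightarrow> \<not> isomorphic X Y"
  unfolding isomorphic_def embeds_isomorphically_def by blast

theorem corollary6p5:
  fixes p q :: real
  assumes "2 < p" and "0 < q" and "q \<le> 1"
  shows
    "\<not> embeds_isomorphically
         (lorentz_space p q {0<..} :: (real, (real \<Rightarrow> real) set) qn_space)
         (lorentz_space p q {0<..<1} :: (real, (real \<Rightarrow> real) set) qn_space) \<and>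
     \<not> isomorphic
         (lorentz_space p q {0<..} :: (real, (real \<Rightarrow> real) set) qn_space)
         (lorentz_space p q {0<..<1} :: (real, (real \<Rightarrow> real) set) qn_space) \<and>
     \<not> embeds_isomorphically
         (lorentz_space p q {0<..} :: (complex, (real \<Rightarrow> complex) set) qn_space)
         (lorentz_space p q {0<..<1} :: (complex, (real \<Rightarrow> complex) set) qn_space) \<and>
     \<not> isomorphic
         (lorentz_space p q {0<..} :: (complex, (real \<Rightarrow> complex) set) qn_space)
         (lorentz_space p q {0<..<1} :: (complex, (real \<Rightarrow> complex) set) qn_space)"
  by (intro conjI not_isomorphic_if_not_embeds not_embeds_lorentz_space[OF assms])

end
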